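(* There exists $\delta_0>0$ such that for every $\lambda$ with $0<\lambda_{LSW}-\lambda<\delta_0$ there exist $\varepsilon>0$ and an exponentially decaying function $\Phi:[0,\infty)\to\mathbb R$ which solves, for all $z>0$, $$-z\frac{\partial\Phi}{\partial z}-2\Phi+\frac{\partial}{\partial z}\Big(\big(-1+\lambda z^{1/3}\big)\Phi\Big)=\varepsilon J[\Phi](z),\qquad \int_0^\infty z\Phi(z)\,dz=1,\qquad \Phi(z)\ge 0,$$ and $$\lambda=\frac{\int_0^\infty\Phi(z)\,dz}{\int_0^\infty z^{1/3}\Phi(z)\,dz}.$$
   Context: $\lambda_{LSW}:=3\left(\tfrac12\right)^{2/3}$. The coagulation term is $$J[\Phi](z)=\frac12\int_0^z z\,\Phi(z-z')\Phi(z')\,dz'-\Phi(z)\int_0^\infty (z+z')\Phi(z')\,dz'.$$ A solution is understood in the classical sense: $\Phi$ is continuous on $[0,\infty)$ and continuously differentiable on $(0,\infty)$. Exponentially decaying means that there is $\beta>0$ with $\sup_{z\ge 0}|\Phi(z)|e^{\beta z}<\infty$. *)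

theory Defs
  imports "HOL-Analysis.Analysis"
begin

text \<open>
  Functions on the half-line \<open>[0,\<infinity>)\<close> are rendered as total functions on the reals; every notion
  below only looks at their values on \<open>{0..}\<close>.
\<close>

definition lambda_LSW :: real where
  "lambda_LSW = 3 * (1 / 2) powr (2 / 3)"

definition coagulation :: "(real \<Rightarrow> real) \<Rightarrow> real \<Rightarrow> real" where
  "coagulation \<Phi> z =
     1 / 2 * (LBINT z':{0..z}. z * \<Phi> (z - z') * \<Phi> z')
     - \<Phi> z * (LBINT z':{0..}. (z + z') * \<Phi> z')"

definition classical_regularity :: "(real \<Rightarrow> real) \<Rightarrow> bool" where
  "classical_regularity \<Phi> \<longleftrightarrow> continuous_on {0..} \<Phi> \<and> \<Phi> C1_differentiable_on {0<..}"

text \<open>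
  Boundedness is stated explicitly because \<open>Sup\<close> of an unbounded set of reals is an unspecified
  real number. For a function with \<open>classical_regularity\<close>, exponential decay makes all the
  integrals over \<open>{0..}\<close> occurring here converge absolutely, so none of them takes the default
  value \<open>0\<close> of a non-integrable function.
\<close>

definition exponentially_decaying :: "(real \<Rightarrow> real) \<Rightarrow> bool" where
  "exponentially_decaying \<Phi> \<longleftrightarrow>
     (\<exists>\<beta>>0. bdd_above ((\<lambda>z. \<bar>\<Phi> z\<bar> * exp (\<beta> * z)) ` {0..}))"

end

theory Submission
  imports Defs "HOL-Real_Asymp.Real_Asymp"
begin

text \<open>
  Put \<open>a(z) = z + 1 - \<lambda> z\<^sup>1\<^sup>/\<^sup>3\<close> and \<open>\<delta> = \<lambda>\<^sub>L\<^sub>S\<^sub>W - \<lambda>\<close>. The critical value \<open>\<lambda>\<^sub>L\<^sub>S\<^sub>W\<close> is the minimum of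
  \<open>(z + 1) / z\<^sup>1\<^sup>/\<^sup>3\<close>, attained at \<open>z = 1/2\<close>; for \<open>\<delta> > 0\<close> the drift \<open>a\<close> is therefore positive, with a
  bottleneck of height about \<open>\<delta>\<close> and width about \<open>\<surd>\<delta>\<close> at \<open>1/2\<close>. The equation reads
  \<open>(a \<Phi>)' = - \<Phi> - \<epsilon> J[\<Phi>]\<close>, so with \<open>P(z) = exp (\<integral>\<^sub>0\<^sup>z 1/a)\<close> its decaying solutions are those of
  \<open>\<Phi>(z) = \<epsilon> / (a(z) P(z)) \<integral>\<^sub>z\<^sup>\<infinity> P J[\<Phi>]\<close>.

  Two of the requirements cost nothing. Multiplying by \<open>z\<close> and integrating, \<open>\<integral> z J[\<Phi>] = 0\<close> gives
  \<open>\<integral> a \<Phi> = \<integral> z \<Phi>\<close>, which is the formula for \<open>\<lambda>\<close>. Since \<open>J\<close> is quadratic, the factor needed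
  for \<open>\<integral> z \<Phi> = 1\<close> can be moved into \<open>\<epsilon>\<close>. What remains is a nonzero, nonnegative, exponentially
  decaying solution for some \<open>\<epsilon> > 0\<close>. Prescribing \<open>\<Phi>(0) = 1/a(0)\<close> forces
  \<open>\<epsilon> = 1/q\<close> with \<open>q = \<integral>\<^sub>0\<^sup>\<infinity> P J[\<Phi>]\<close>, so \<open>\<Phi>\<close> has to be a fixed point of the map \<open>step\<close>,
  \<open>\<Phi> \<mapsto> (\<integral>\<^sub>z\<^sup>\<infinity> P J[\<Phi>]) / (q a P)\<close>, a quotient of two quadratic expressions.

  The bottleneck makes this map a contraction. Through it, \<open>P\<close> climbs from a bounded value at
  \<open>z\<^sub>1 = 2/5\<close> to the value \<open>p = P(z\<^sub>0) \<ge> exp (1 / (4 \<surd>\<delta>))\<close> at \<open>z\<^sub>0 = 3/5\<close>, and \<open>p\<close> beats every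
  power of \<open>1/\<delta>\<close>. Two sizes in \<open>[z\<^sub>0/2, z\<^sub>1)\<close> coagulate to one beyond \<open>z\<^sub>0\<close>, where \<open>P \<ge> p\<close>;
  hence \<open>q\<close> is at least a constant times \<open>p\<close>, that is, \<open>\<epsilon>\<close> is at most of order
  \<open>1/p\<close>. On \<open>[0, z\<^sub>0]\<close> the image then differs from the coagulation-free profile \<open>1/(a P)\<close> by at
  most \<open>1/p\<close> times a power of \<open>1/\<delta>\<close>. Beyond \<open>z\<^sub>0\<close> each further
  coagulation costs a factor \<open>\<epsilon>\<close>, which produces decay like \<open>exp (- b z)\<close>; the choice that makes
  everything fit is \<open>E = exp (b z\<^sub>0)\<close> of order \<open>\<surd>p\<close>, up to powers of \<open>\<delta>\<close>. Then \<open>step\<close> halves distances in the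
  norm \<open>sup \<bar>\<Phi>\<bar> / weight\<close>, and Banach's fixed point theorem applies
  (\<open>adm_step\<close>, \<open>step_contract\<close>, \<open>fixed_point_exists\<close>).

  Positivity of \<open>\<integral>\<^sub>z\<^sup>\<infinity> P J[\<Phi>]\<close> is the point that is not perturbative for large \<open>z\<close>, because \<open>J\<close>
  changes sign. It follows from the weak form
  \<open>2 \<integral> \<phi> J[\<Phi>] = \<integral>\<integral> (x + y) (\<phi>(x + y) - \<phi>(x) - \<phi>(y)) \<Phi>(x) \<Phi>(y)\<close>: where \<open>a(x) \<le> x\<close>, the quotient
  \<open>P(x)/x\<close> is nondecreasing, which makes \<open>\<phi> = 1\<^bsub>[z,\<infinity>)\<^esub> P\<close> superadditive. The same inequality gives
  the lower bound on \<open>q\<close>.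
\<close>

section \<open>Exponentially weighted functions and the coagulation form\<close>

text \<open>
  The algebraic factor makes the weight almost closed under convolution: a pure exponential
  gains a factor \<open>x\<close> when convolved with itself, while \<open>weight b * weight b \<le> 8 weight b\<close>.
\<close>

definition weight :: "real \<Rightarrow> real \<Rightarrow> real" where
  "weight b x = exp (- b * x) / (1 + x)\<^sup>2"

definition dominated :: "real \<Rightarrow> real \<Rightarrow> (real \<Rightarrow> real) \<Rightarrow> bool" where
  "dominated b D f \<longleftrightarrow> continuous_on {0..} f \<and> (\<forall>x\<ge>0. \<bar>f x\<bar> \<le> D * weight b x)"

definition conv :: "(real \<Rightarrow> real) \<Rightarrow> (real \<Rightarrow> real) \<Rightarrow> real \<Rightarrow> real" where
  "conv f g x = (LBINT y:{0..x}. f (x - y) * g y)"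

definition mom0 :: "(real \<Rightarrow> real) \<Rightarrow> real" where
  "mom0 f = (LBINT y:{0..}. f y)"

definition mom1 :: "(real \<Rightarrow> real) \<Rightarrow> real" where
  "mom1 f = (LBINT y:{0..}. y * f y)"

text \<open>
  The symmetric bilinear form whose diagonal is the coagulation operator. Polarisation turns
  differences \<open>J[f] - J[g]\<close> into \<open>coag_form (f + g) (f - g)\<close>, so one pair of bilinear bounds serves both
  the size estimates and the Lipschitz estimates.
\<close>

definition coag_form :: "(real \<Rightarrow> real) \<Rightarrow> (real \<Rightarrow> real) \<Rightarrow> real \<Rightarrow> real" where
  "coag_form f g x = x / 2 * conv f g x
     - (f x * (x * mom0 g + mom1 g) + g x * (x * mom0 f + mom1 f)) / 2"

lemma set_integral_exp_tail:
  fixes b c :: real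
  assumes "0 < b"
  shows "set_integrable lborel {c..} (\<lambda>x. exp (- b * x))"
    and "(LBINT x:{c..}. exp (- b * x)) = exp (- b * c) / b"
proof -
  have h: "((\<lambda>x. exp (- b * x)) has_integral exp (- b * c) / b) {c..}"
    by (rule has_integral_exp_minus_to_infinity[OF assms])
  have "(\<lambda>x. exp (- b * x)) absolutely_integrable_on {c..}"
    by (rule nonnegative_absolutely_integrable_1) (use h in auto)
  then show i: "set_integrable lborel {c..} (\<lambda>x. exp (- b * x))"
    unfolding set_integrable_def by (subst (asm) integrable_completion) auto
  show "(LBINT x:{c..}. exp (- b * x)) = exp (- b * c) / b"
    using set_borel_integral_eq_integral(2)[OF i] h by (simp add: integral_unique)
qed

lemma exp_dominated_integral:
  fixes f :: "real \<Rightarrow> real"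
  assumes "continuous_on {c..} f" "\<And>x. x \<ge> c \<Longrightarrow> \<bar>f x\<bar> \<le> C * exp (- b * x)" "0 < b"
  shows "set_integrable lborel {c..} f"
    and "\<bar>LBINT x:{c..}. f x\<bar> \<le> C * exp (- b * c) / b"
proof -
  have e: "set_integrable lborel {c..} (\<lambda>x. C * exp (- b * x))"
    using set_integral_exp_tail(1)[OF assms(3)] by (intro set_integrable_mult_right) auto
  have m: "set_borel_measurable lborel {c..} f"
    using set_measurable_continuous_on[OF _ assms(1)] by (simp add: set_borel_measurable_def)
  show i: "set_integrable lborel {c..} f"
    by (rule set_integrable_bound[OF e m]) (use assms(2) in \<open>auto intro!: AE_I2 order_trans[OF assms(2)]\<close>)
  have "\<bar>LBINT x:{c..}. f x\<bar> \<le> (LBINT x:{c..}. \<bar>f x\<bar>)"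
    using set_integral_norm_bound[OF i] by simp
  also have "\<dots> \<le> (LBINT x:{c..}. C * exp (- b * x))"
    by (rule set_integral_mono[OF set_integrable_abs[OF i] e]) (use assms(2) in auto)
  also have "\<dots> = C * exp (- b * c) / b"
    using set_integral_exp_tail(2)[OF assms(3), of c] by simp
  finally show "\<bar>LBINT x:{c..}. f x\<bar> \<le> C * exp (- b * c) / b" .
qed

lemma compact_integral_bound:
  fixes f :: "real \<Rightarrow> real"
  assumes "continuous_on {c..d} f" "\<And>x. c \<le> x \<Longrightarrow> x \<le> d \<Longrightarrow> \<bar>f x\<bar> \<le> C" "c \<le> d"
  shows "\<bar>LBINT x:{c..d}. f x\<bar> \<le> C * (d - c)"
proof -
  have i: "set_integrable lborel {c..d} f" by (rule borel_integrable_atLeastAtMost'[OF assms(1)])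
  have e: "set_integrable lborel {c..d} (\<lambda>x. C)" by (rule borel_integrable_atLeastAtMost') auto
  have "\<bar>LBINT x:{c..d}. f x\<bar> \<le> (LBINT x:{c..d}. \<bar>f x\<bar>)"
    using set_integral_norm_bound[OF i] by simp
  also have "\<dots> \<le> (LBINT x:{c..d}. C)"
    by (rule set_integral_mono[OF set_integrable_abs[OF i] e]) (use assms(2) in auto)
  also have "\<dots> = C * (d - c)" using assms(3) by (simp add: set_lebesgue_integral_def)
  finally show ?thesis .
qed

lemma set_integral_split:
  fixes f :: "real \<Rightarrow> real"
  assumes "set_integrable lborel {c..} f" "c \<le> z"
  shows "(LBINT x:{c..}. f x) = (LBINT x:{c..z}. f x) + (LBINT x:{z..}. f x)"
proof -
  have "(LBINT x:{c..z} \<union> {z..}. f x) = (LBINT x:{c..z}. f x) + (LBINT x:{z..}. f x)"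
  proof (rule set_integral_Un_AE)
    show "AE x in lborel. \<not> (x \<in> {c..z} \<and> x \<in> {z..})"
      using AE_lborel_singleton[of z] by eventually_elim auto
  qed (use assms in \<open>auto intro: set_integrable_subset\<close>)
  moreover have "{c..z} \<union> {z..} = {c..}" using assms(2) by auto
  ultimately show ?thesis by simp
qed

lemma weight_pos: "x \<ge> 0 \<Longrightarrow> weight b x > 0"
  by (simp add: weight_def)

lemma weight_le_exp: "x \<ge> 0 \<Longrightarrow> weight b x \<le> exp (- b * x)"
  unfolding weight_def by (simp add: divide_le_eq mult_le_cancel_left1)

lemma mult_weight_le_exp: 
  assumes "x \<ge> 0" shows "x * weight b x \<le> exp (- b * x)"
proof -
  have "x \<le> (1 + x)\<^sup>2" using assms by (simp add: power2_eq_square algebra_simps)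
  then show ?thesis using assms unfolding weight_def by (simp add: divide_le_eq)
qed

lemma weight_mult: "x \<ge> 0 \<Longrightarrow> (1 + x) * weight b x = exp (- b * x) / (1 + x)"
  by (simp add: weight_def power2_eq_square)

lemma continuous_on_weight: "continuous_on {0..} (weight b)"
  unfolding weight_def by (intro continuous_intros) auto

lemma dominatedD:
  assumes "dominated b D f"
  shows "continuous_on {0..} f" "\<And>x. x \<ge> 0 \<Longrightarrow> \<bar>f x\<bar> \<le> D * weight b x"
  using assms by (auto simp: dominated_def)

lemma dominated_nonneg: 
  assumes "dominated b D f" shows "D \<ge> 0"
proof -
  have "0 \<le> \<bar>f 0\<bar>" by simp
  also have "\<bar>f 0\<bar> \<le> D * weight b 0" by (rule dominatedD[OF assms]) simp
  finally show ?thesis by (simp add: weight_def)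
qed

lemma dominated_le_exp:
  assumes "dominated b D f" "x \<ge> 0"
  shows "\<bar>f x\<bar> \<le> D * exp (- b * x)" "\<bar>x * f x\<bar> \<le> D * exp (- b * x)"
proof -
  have D: "D \<ge> 0" by (rule dominated_nonneg[OF assms(1)])
  have f: "\<bar>f x\<bar> \<le> D * weight b x" by (rule dominatedD(2)[OF assms])
  show "\<bar>f x\<bar> \<le> D * exp (- b * x)"
    using f mult_left_mono[OF weight_le_exp[OF assms(2)] D] by (rule order_trans)
  have "\<bar>x * f x\<bar> = x * \<bar>f x\<bar>" using assms(2) by (simp add: abs_mult)
  also have "\<dots> \<le> x * (D * weight b x)" using f assms(2) by (rule mult_left_mono)
  also have "\<dots> = D * (x * weight b x)" by simp
  also have "\<dots> \<le> D * exp (- b * x)" by (rule mult_left_mono[OF mult_weight_le_exp[OF assms(2)] D])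
  finally show "\<bar>x * f x\<bar> \<le> D * exp (- b * x)" .
qed

lemma dominated_moments:
  assumes "dominated b D f" "b \<ge> 1"
  shows "set_integrable lborel {0..} f" "set_integrable lborel {0..} (\<lambda>x. x * f x)"
    "\<bar>mom0 f\<bar> \<le> D" "\<bar>mom1 f\<bar> \<le> D"
proof -
  have b: "0 < b" and D: "D \<ge> 0" using assms dominated_nonneg by auto
  have Db: "D * exp (- b * 0) / b \<le> D" using assms(2) D by (simp add: divide_le_eq mult_le_cancel_left1)
  have c: "continuous_on {0..} (\<lambda>x. x * f x)" by (intro continuous_intros dominatedD[OF assms(1)])
  note 1 = exp_dominated_integral[OF dominatedD(1)[OF assms(1)] dominated_le_exp(1)[OF assms(1)] b]
  note 2 = exp_dominated_integral[OF c dominated_le_exp(2)[OF assms(1)] b]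
  show "set_integrable lborel {0..} f" "set_integrable lborel {0..} (\<lambda>x. x * f x)"
    using 1(1) 2(1) by auto
  show "\<bar>mom0 f\<bar> \<le> D" "\<bar>mom1 f\<bar> \<le> D"
    using order_trans[OF 1(2) Db] order_trans[OF 2(2) Db] by (auto simp: mom0_def mom1_def)
qed

lemma dominated_add:
  assumes "dominated b D f" "dominated b D' g"
  shows "dominated b (D + D') (\<lambda>x. f x + g x)"
  using assms unfolding dominated_def
  by (auto intro!: continuous_intros simp: distrib_right intro: order_trans[OF abs_triangle_ineq] add_mono)

lemma conv_integrable:
  fixes f g :: "real \<Rightarrow> real"
  assumes "continuous_on {0..} f" "continuous_on {0..} g"
  shows "set_integrable lborel {0..x} (\<lambda>y. f (x - y) * g y)"
proof (rule borel_integrable_atLeastAtMost')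
  show "continuous_on {0..x} (\<lambda>y. f (x - y) * g y)"
    by (intro continuous_on_mult continuous_on_compose2[OF assms(1)] continuous_on_subset[OF assms(2)] continuous_intros) auto
qed

lemma conv_commute: "conv f g x = conv g f x"
proof -
  have "conv f g x = (LBINT y. indicator {0..x} y * (f (x - y) * g y))"
    by (simp add: conv_def set_lebesgue_integral_def)
  also have "\<dots> = (LBINT y. indicator {0..x} (x + (-1) * y) * (f (x - (x + (-1) * y)) * g (x + (-1) * y)))"
    using lborel_integral_real_affine[of "-1" "\<lambda>y. indicator {0..x} y * (f (x - y) * g y)" x] by simp
  also have "\<dots> = conv g f x"
    unfolding conv_def set_lebesgue_integral_def
    by (intro Bochner_Integration.integral_cong) (auto simp: indicator_def)
  finally show ?thesis .
qed

text \<open>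
  Scaling to a fixed interval of integration, so that continuity of the convolution becomes
  continuity of a parameter integral.
\<close>

lemma conv_rescaled:
  assumes "x \<ge> 0"
  shows "conv f g x = x * (LBINT t:{0..1}. f (x * (1 - t)) * g (x * t))"
proof (cases "x = 0")
  case True
  have "AE y in lborel. indicator {0..0} y *\<^sub>R (f (0 - y) * g y) = 0"
    using AE_lborel_singleton[of 0] by eventually_elim auto
  then show ?thesis using True by (simp add: conv_def set_lebesgue_integral_def integral_eq_zero_AE)
next
  case False
  then have x: "x > 0" using assms by simp
  have "conv f g x = (LBINT y. indicator {0..x} y * (f (x - y) * g y))"
    by (simp add: conv_def set_lebesgue_integral_def)
  also have "\<dots> = x * (LBINT t. indicator {0..x} (0 + x * t) * (f (x - (0 + x * t)) * g (0 + x * t)))"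
    using lborel_integral_real_affine[of x "\<lambda>y. indicator {0..x} y * (f (x - y) * g y)" 0] x by simp
  also have "(LBINT t. indicator {0..x} (0 + x * t) * (f (x - (0 + x * t)) * g (0 + x * t)))
      = (LBINT t:{0..1}. f (x * (1 - t)) * g (x * t))"
    unfolding set_lebesgue_integral_def
    using x by (intro Bochner_Integration.integral_cong) (auto simp: indicator_def algebra_simps zero_le_mult_iff)
  finally show ?thesis .
qed

lemma continuous_on_conv:
  assumes "continuous_on {0..} f" "continuous_on {0..} g"
  shows "continuous_on {0..} (conv f g)"
proof -
  have c: "continuous_on ({0..} \<times> cbox 0 1) (\<lambda>(x, t). f (x * (1 - t)) * g (x * t))"
    unfolding case_prod_unfold
    by (intro continuous_intros continuous_on_compose2[OF assms(1)] continuous_on_compose2[OF assms(2)]) (auto simp: mult_nonneg_nonneg)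
  have i: "continuous_on {0..} (\<lambda>x. integral (cbox 0 1) (\<lambda>t. f (x * (1 - t)) * g (x * t)))"
    by (rule integral_continuous_on_param[OF c])
  have eq: "x * integral (cbox 0 1) (\<lambda>t. f (x * (1 - t)) * g (x * t)) = conv f g x" if "x \<in> {0..}" for x
  proof -
    have x: "x \<ge> 0" using that by simp
    have "set_integrable lborel {0..1} (\<lambda>t. f (x * (1 - t)) * g (x * t))"
      using x by (intro borel_integrable_atLeastAtMost' continuous_intros continuous_on_compose2[OF assms(1)] continuous_on_compose2[OF assms(2)]) auto
    from set_borel_integral_eq_integral(2)[OF this] show ?thesis by (simp add: conv_rescaled[OF x])
  qed
  have "continuous_on {0..} (\<lambda>x. x * integral (cbox 0 1) (\<lambda>t. f (x * (1 - t)) * g (x * t)))"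
    by (intro continuous_intros i)
  then show ?thesis using eq by (subst continuous_on_cong[OF refl, symmetric]) auto
qed

lemma continuous_on_coag_form:
  assumes "continuous_on {0..} f" "continuous_on {0..} g"
  shows "continuous_on {0..} (coag_form f g)"
  unfolding coag_form_def by (intro continuous_intros assms continuous_on_conv) auto

lemma conv_add_diff:
  assumes f: "continuous_on {0..} f" and g: "continuous_on {0..} g"
  shows "conv (\<lambda>x. f x + g x) (\<lambda>x. f x - g x) x = conv f f x - conv g g x"
proof -
  have i: "set_integrable lborel {0..x} (\<lambda>y. u (x - y) * v y)" if "u = f \<or> u = g" "v = f \<or> v = g" for u v
    using that f g conv_integrable by auto
  have "conv (\<lambda>x. f x + g x) (\<lambda>x. f x - g x) x =
     (LBINT y:{0..x}. (f (x - y) * f y - f (x - y) * g y) + (g (x - y) * f y - g (x - y) * g y))"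
    by (simp add: conv_def algebra_simps)
  also have "\<dots> = (conv f f x - conv f g x) + (conv g f x - conv g g x)"
    by (simp add: conv_def i)
  finally show ?thesis using conv_commute[of f g x] by simp
qed

lemma coag_form_diff:
  assumes f: "dominated b D f" and g: "dominated b D' g" and b: "b \<ge> 1"
  shows "coag_form f f x - coag_form g g x = coag_form (\<lambda>x. f x + g x) (\<lambda>x. f x - g x) x"
proof -
  note mf = dominated_moments[OF f b] and mg = dominated_moments[OF g b]
  have m0: "mom0 (\<lambda>x. f x + g x) = mom0 f + mom0 g" "mom0 (\<lambda>x. f x - g x) = mom0 f - mom0 g"
    using mf mg by (simp_all add: mom0_def)
  have m1: "mom1 (\<lambda>x. f x + g x) = mom1 f + mom1 g" "mom1 (\<lambda>x. f x - g x) = mom1 f - mom1 g"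
    using mf mg by (simp_all add: mom1_def distrib_left right_diff_distrib)
  show ?thesis
    unfolding coag_form_def m0 m1 conv_add_diff[OF dominatedD(1)[OF f] dominatedD(1)[OF g]]
    by (simp add: algebra_simps) (simp add: field_simps)
qed

text \<open>
  One of \<open>1 + y\<close> and \<open>1 + (x - y)\<close> is at least \<open>(1 + x)/2\<close>; in symmetric form,
  \<open>(1 + x)\<^sup>2 \<le> 4 (s\<^sup>2 + t\<^sup>2)\<close> with \<open>s = 1 + y\<close> and \<open>t = 1 + (x - y)\<close>. Hence the product of the two
  algebraic factors is at most \<open>4 / (1 + x)\<^sup>2\<close> times a sum of two functions, each of integral
  at most \<open>1\<close>.
\<close>

lemma weight_conv: 
  assumes "x \<ge> 0"
  shows "conv (weight b) (weight b) x \<le> 8 * weight b x"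
proof -
  \<comment> \<open>majorant of the product of the algebraic factors, with an elementary primitive\<close>
  define k where "k y = 4 / (1 + x)\<^sup>2 * ((1 / (1 + y)\<^sup>2) + 1 / (1 + (x - y))\<^sup>2)" for y
  have pt: "weight b (x - y) * weight b y \<le> exp (- b * x) * k y" if y: "0 \<le> y" "y \<le> x" for y
  proof -
    define s t where "s = 1 + y" and "t = 1 + (x - y)"
    have st: "s > 0" "t > 0" "1 + x \<le> s + t" using y by (auto simp: s_def t_def)
    have "(1 + x)\<^sup>2 \<le> (s + t)\<^sup>2" using st assms by (intro power_mono) auto
    also have "\<dots> \<le> 4 * (s\<^sup>2 + t\<^sup>2)"
    proof -
      have "2 * s * t \<le> 1 * (s\<^sup>2 + t\<^sup>2)" by (simp add: sum_squares_bound)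
      also have "\<dots> \<le> 3 * (s\<^sup>2 + t\<^sup>2)" by (rule mult_right_mono) auto
      finally show ?thesis by (simp add: power2_sum)
    qed
    finally have "(1 + x)\<^sup>2 \<le> 4 * (s\<^sup>2 + t\<^sup>2)" .
    then have "1 / (t\<^sup>2 * s\<^sup>2) \<le> 4 / (1 + x)\<^sup>2 * (1 / s\<^sup>2 + 1 / t\<^sup>2)"
      using st assms by (simp add: field_simps)
    then have "exp (- b * x) * (1 / (t\<^sup>2 * s\<^sup>2)) \<le> exp (- b * x) * k y"
      unfolding k_def s_def t_def by (intro mult_left_mono) auto
    moreover have "weight b (x - y) * weight b y = exp (- b * x) * (1 / (t\<^sup>2 * s\<^sup>2))"
      by (simp add: weight_def s_def t_def exp_add[symmetric] algebra_simps)
    ultimately show ?thesis by simp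
  qed
  have ck: "continuous_on {0..x} k" unfolding k_def by (intro continuous_intros) auto
  have ik: "(k has_integral 4 / (1 + x)\<^sup>2 * (2 - 2 / (1 + x))) {0..x}"
  proof -
    define m where "m y = - 1 / (1 + y) + 1 / (1 + (x - y))" for y
    have d: "(m has_real_derivative 1 / (1 + y)\<^sup>2 + 1 / (1 + (x - y))\<^sup>2) (at y within {0..x})"
      if "0 \<le> y" "y \<le> x" for y
      unfolding m_def using that
      by (auto intro!: derivative_eq_intros simp: power2_eq_square)
    have "(k has_integral 4 / (1 + x)\<^sup>2 * m x - 4 / (1 + x)\<^sup>2 * m 0) {0..x}"
    proof (rule fundamental_theorem_of_calculus[OF assms])
      fix y assume "y \<in> {0..x}"
      then show "((\<lambda>y. 4 / (1 + x)\<^sup>2 * m y) has_vector_derivative k y) (at y within {0..x})"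
        unfolding k_def has_real_derivative_iff_has_vector_derivative[symmetric]
        by (intro DERIV_cmult d) auto
    qed
    moreover have "4 / (1 + x)\<^sup>2 * m x - 4 / (1 + x)\<^sup>2 * m 0 = 4 / (1 + x)\<^sup>2 * (2 - 2 / (1 + x))"
      by (simp only: right_diff_distrib[symmetric]) (simp add: m_def)
    ultimately show ?thesis by simp
  qed
  have si: "set_integrable lborel {0..x} (\<lambda>y. exp (- b * x) * k y)"
    by (intro borel_integrable_atLeastAtMost' continuous_intros ck)
  have "conv (weight b) (weight b) x \<le> (LBINT y:{0..x}. exp (- b * x) * k y)"
    unfolding conv_def
    by (rule set_integral_mono[OF conv_integrable[OF continuous_on_weight continuous_on_weight] si]) (use pt in auto)
  also have "\<dots> = exp (- b * x) * (4 / (1 + x)\<^sup>2 * (2 - 2 / (1 + x)))"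
    using set_borel_integral_eq_integral(2)[OF borel_integrable_atLeastAtMost'[OF ck]] ik
    by (simp add: integral_unique)
  also have "\<dots> \<le> exp (- b * x) * (4 / (1 + x)\<^sup>2 * 2)"
    using assms by (intro mult_left_mono) auto
  finally show ?thesis by (simp add: weight_def mult.commute)
qed

lemma conv_bound_weight:
  assumes f: "dominated b D f" and g: "dominated b D' g" and x: "x \<ge> 0"
  shows "\<bar>conv f g x\<bar> \<le> 8 * D * D' * weight b x"
proof -
  have D: "D \<ge> 0" "D' \<ge> 0" using f g dominated_nonneg by auto
  note i = conv_integrable[OF dominatedD(1)[OF f] dominatedD(1)[OF g]]
  note w = conv_integrable[OF continuous_on_weight[of b] continuous_on_weight[of b]]
  have "\<bar>conv f g x\<bar> \<le> (LBINT y:{0..x}. \<bar>f (x - y) * g y\<bar>)"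
    unfolding conv_def using set_integral_norm_bound[OF i] by simp
  also have "\<dots> \<le> (LBINT y:{0..x}. D * D' * (weight b (x - y) * weight b y))"
  proof (rule set_integral_mono[OF set_integrable_abs[OF i]])
    show "set_integrable lborel {0..x} (\<lambda>y. D * D' * (weight b (x - y) * weight b y))"
      using w by auto
    fix y assume "y \<in> {0..x}"
    then have "\<bar>f (x - y)\<bar> * \<bar>g y\<bar> \<le> (D * weight b (x - y)) * (D' * weight b y)"
      using D weight_pos[of "x-y" b] by (intro mult_mono dominatedD[OF f] dominatedD[OF g]) auto
    then show "\<bar>f (x - y) * g y\<bar> \<le> D * D' * (weight b (x - y) * weight b y)"
      by (simp add: abs_mult mult_ac)
  qed
  also have "\<dots> = D * D' * conv (weight b) (weight b) x" by (simp add: conv_def)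
  also have "\<dots> \<le> D * D' * (8 * weight b x)"
    using D by (intro mult_left_mono weight_conv x) auto
  finally show ?thesis by simp
qed

lemma abs_gain_minus_loss_le:
  fixes p q r a b c :: real
  assumes "\<bar>p\<bar> \<le> a" "\<bar>q\<bar> \<le> b" "\<bar>r\<bar> \<le> c"
  shows "\<bar>p - (q + r) / 2\<bar> \<le> a + b / 2 + c / 2"
  using assms by (auto simp: abs_le_iff field_simps)

lemma gain_bound_weight:
  assumes f: "dominated b D f" and g: "dominated b D' g" and x: "x \<ge> 0"
  shows "\<bar>x / 2 * conv f g x\<bar> \<le> 4 * (D * D' * ((1 + x) * weight b x))"
proof -
  have D: "D \<ge> 0" "D' \<ge> 0" using f g dominated_nonneg by auto
  have w: "weight b x > 0" by (rule weight_pos[OF x])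
  have "\<bar>x / 2 * conv f g x\<bar> \<le> x / 2 * (8 * D * D' * weight b x)"
    unfolding abs_mult using conv_bound_weight[OF f g x] x by (intro mult_mono) auto
  also have "\<dots> \<le> 4 * (D * D' * ((1 + x) * weight b x))"
    using D w x by (simp add: algebra_simps)
  finally show ?thesis .
qed

lemma loss_bound_weight:
  assumes u: "dominated b E u" and v: "dominated b E' v" and x: "x \<ge> 0" and b: "b \<ge> 1"
  shows "\<bar>u x * (x * mom0 v + mom1 v)\<bar> \<le> E * E' * ((1 + x) * weight b x)"
proof -
  have E: "E \<ge> 0" "E' \<ge> 0" using u v dominated_nonneg by auto
  have w: "weight b x > 0" by (rule weight_pos[OF x])
  have "\<bar>x * mom0 v + mom1 v\<bar> \<le> x * E' + E'"
    using dominated_moments(3,4)[OF v b] x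
    by (intro order_trans[OF abs_triangle_ineq] add_mono) (auto simp: abs_mult mult_left_mono)
  then have "\<bar>u x\<bar> * \<bar>x * mom0 v + mom1 v\<bar> \<le> (E * weight b x) * (x * E' + E')"
    using dominatedD(2)[OF u x] E w by (intro mult_mono) auto
  then show ?thesis by (simp only: abs_mult) (simp add: algebra_simps)
qed

text \<open>
  The factors \<open>x\<close> in gain and loss cost one power of \<open>1 + x\<close>, so the weight drops from
  \<open>(1 + x)\<^sup>-\<^sup>2\<close> to \<open>(1 + x)\<^sup>-\<^sup>1\<close>; dividing by a drift that grows linearly restores it.
\<close>

lemma coag_form_bound_weight:
  assumes f: "dominated b D f" and g: "dominated b D' g" and x: "x \<ge> 0" and b: "b \<ge> 1"
  shows "\<bar>coag_form f g x\<bar> \<le> 5 * D * D' * (exp (- b * x) / (1 + x))"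
proof -
  have "\<bar>coag_form f g x\<bar> \<le> 5 * (D * D' * ((1 + x) * weight b x))"
    using abs_gain_minus_loss_le[OF gain_bound_weight[OF f g x] loss_bound_weight[OF f g x b] loss_bound_weight[OF g f x b]]
    unfolding coag_form_def by (simp only: mult.commute[of D' D])
  then show ?thesis by (simp add: weight_mult[OF x])
qed

text \<open>
  On bounded sizes the weighted norms are wasteful, because they are of the order of the large number
  \<open>exp (b z\<^sub>0)\<close>; here only sup bounds on \<open>[0, x]\<close> and the moments enter.
\<close>

lemma coag_form_bound_near:
  assumes f: "continuous_on {0..} f" and g: "continuous_on {0..} g"
    and x: "0 \<le> x" "x \<le> 1"
    and bf: "\<And>y. 0 \<le> y \<Longrightarrow> y \<le> x \<Longrightarrow> \<bar>f y\<bar> \<le> A" and bg: "\<And>y. 0 \<le> y \<Longrightarrow> y \<le> x \<Longrightarrow> \<bar>g y\<bar> \<le> A'"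
    and mf: "\<bar>mom0 f\<bar> \<le> M" "\<bar>mom1 f\<bar> \<le> M" and mg: "\<bar>mom0 g\<bar> \<le> M'" "\<bar>mom1 g\<bar> \<le> M'"
  shows "\<bar>coag_form f g x\<bar> \<le> A * A' + A * M' + A' * M"
proof -
  have A: "A \<ge> 0" "A' \<ge> 0" using bf[of 0] bg[of 0] x by auto
  have "\<bar>conv f g x\<bar> \<le> A * A' * (x - 0)"
    unfolding conv_def
  proof (rule compact_integral_bound)
    show "continuous_on {0..x} (\<lambda>y. f (x - y) * g y)"
      by (intro continuous_intros continuous_on_compose2[OF f] continuous_on_subset[OF g]) auto
    show "\<bar>f (x - y) * g y\<bar> \<le> A * A'" if "0 \<le> y" "y \<le> x" for y
      using that A by (simp add: abs_mult) (intro mult_mono bf bg, auto)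
  qed fact
  also have "\<dots> \<le> A * A'" using x A by (simp add: mult_left_le)
  finally have "x / 2 * \<bar>conv f g x\<bar> \<le> 1 * (A * A')" using x A by (intro mult_mono) auto
  then have 1: "\<bar>x / 2 * conv f g x\<bar> \<le> A * A'" using x by (simp add: abs_mult)
  have lin: "\<bar>x * p + q\<bar> \<le> 2 * N" if "\<bar>p\<bar> \<le> N" "\<bar>q\<bar> \<le> N" for p q N
  proof -
    have "\<bar>x * p\<bar> \<le> 1 * N" using x that unfolding abs_mult by (intro mult_mono) auto
    then show ?thesis using that by linarith
  qed
  have 2: "\<bar>f x * (x * mom0 g + mom1 g)\<bar> \<le> A * (2 * M')"
    unfolding abs_mult using lin[OF mg] bf[of x] x A by (intro mult_mono) auto
  have 3: "\<bar>g x * (x * mom0 f + mom1 f)\<bar> \<le> A' * (2 * M)"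
    unfolding abs_mult using lin[OF mf] bg[of x] x A by (intro mult_mono) auto
  from abs_gain_minus_loss_le[OF 1, of _ "2 * (A * M')" _ "2 * (A' * M)"] 2 3 show ?thesis
    unfolding coag_form_def by (simp add: mult.left_commute)
qed

lemma coagulation_eq_coag_form:
  assumes "dominated b D f" "b \<ge> 1"
  shows "coagulation f x = coag_form f f x"
proof -
  note m = dominated_moments[OF assms]
  have "(LBINT y:{0..}. (x + y) * f y) = x * mom0 f + mom1 f"
    using m by (simp add: distrib_right mom0_def mom1_def)
  moreover have "(LBINT y:{0..x}. x * f (x - y) * f y) = x * conv f f x"
    by (simp add: conv_def mult.assoc)
  ultimately show ?thesis by (simp add: coagulation_def coag_form_def)
qed

section \<open>Weak form of the coagulation operator\<close>

text \<open>
  Extension by zero lets the convolution run over the whole line, where the shift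
  \<open>x \<mapsto> x + y\<close> in the weak form does not move the limits of integration.
\<close>

definition half_line :: "(real \<Rightarrow> real) \<Rightarrow> real \<Rightarrow> real" where
  "half_line f x = indicator {0..} x * f x"

text \<open>
  Values in the extended nonnegative reals, so that Tonelli's theorem applies without integrability
  conditions; gain and loss are compared there before the difference is formed.
\<close>

definition pair_integral :: "(real \<Rightarrow> real) \<Rightarrow> (real \<Rightarrow> real \<Rightarrow> real) \<Rightarrow> ennreal" where
  "pair_integral f \<psi> = (\<integral>\<^sup>+x. \<integral>\<^sup>+y. ennreal (\<psi> x y * ((x + y) * (half_line f x * half_line f y))) \<partial>lborel \<partial>lborel)"

lemma nn_integral_add_pair:
  fixes F G :: "real \<Rightarrow> real \<Rightarrow> ennreal"
  assumes [measurable]: "case_prod F \<in> borel_measurable (lborel \<Otimes>\<^sub>M lborel)"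
    "case_prod G \<in> borel_measurable (lborel \<Otimes>\<^sub>M lborel)"
  shows "(\<integral>\<^sup>+x. \<integral>\<^sup>+y. F x y \<partial>lborel \<partial>lborel) + (\<integral>\<^sup>+x. \<integral>\<^sup>+y. G x y \<partial>lborel \<partial>lborel)
    = (\<integral>\<^sup>+x. \<integral>\<^sup>+y. F x y + G x y \<partial>lborel \<partial>lborel)"
proof -
  have "(\<integral>\<^sup>+x. \<integral>\<^sup>+y. F x y + G x y \<partial>lborel \<partial>lborel)
    = (\<integral>\<^sup>+x. (\<integral>\<^sup>+y. F x y \<partial>lborel) + (\<integral>\<^sup>+y. G x y \<partial>lborel) \<partial>lborel)"
    by (intro nn_integral_cong nn_integral_add) measurable
  also have "\<dots> = (\<integral>\<^sup>+x. \<integral>\<^sup>+y. F x y \<partial>lborel \<partial>lborel) + (\<integral>\<^sup>+x. \<integral>\<^sup>+y. G x y \<partial>lborel \<partial>lborel)"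
    by (intro nn_integral_add) measurable
  finally show ?thesis ..
qed

context
  fixes b D :: real and f :: "real \<Rightarrow> real"
  assumes dom: "dominated b D f" and b: "b \<ge> 1" and nonneg: "\<And>x. x \<ge> 0 \<Longrightarrow> f x \<ge> 0"
begin

lemma half_line_nonneg: "half_line f x \<ge> 0"
  using nonneg by (auto simp: half_line_def indicator_def)

lemma half_line_measurable [measurable]: "half_line f \<in> borel_measurable borel"
  using set_measurable_continuous_on[OF _ dominatedD(1)[OF dom]]
  by (simp add: set_borel_measurable_def half_line_def[abs_def])

lemma ennreal_conv:
  assumes "x \<ge> 0"
  shows "ennreal (conv f f x) = (\<integral>\<^sup>+y. ennreal (half_line f (x - y) * half_line f y) \<partial>lborel)"
proof -
  have eq: "indicator {0..x} y *\<^sub>R (f (x - y) * f y) = half_line f (x - y) * half_line f y" for y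
    by (auto simp: half_line_def indicator_def)
  have "integrable lborel (\<lambda>y. half_line f (x - y) * half_line f y)"
    using conv_integrable[OF dominatedD(1)[OF dom] dominatedD(1)[OF dom], of x]
    unfolding set_integrable_def eq .
  from nn_integral_eq_integral[OF this] show ?thesis
    using half_line_nonneg by (simp add: conv_def set_lebesgue_integral_def eq[simplified])
qed

lemma ennreal_moments:
  assumes "x \<ge> 0"
  shows "ennreal (x * mom0 f + mom1 f) = (\<integral>\<^sup>+y. ennreal ((x + y) * half_line f y) \<partial>lborel)"
proof -
  note m = dominated_moments[OF dom b]
  have i: "set_integrable lborel {0..} (\<lambda>y. (x + y) * f y)"
    using m by (simp add: distrib_right)
  have eq: "indicator {0..} y *\<^sub>R ((x + y) * f y) = (x + y) * half_line f y" for y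
    by (auto simp: half_line_def indicator_def)
  have "(LBINT y:{0..}. (x + y) * f y) = x * mom0 f + mom1 f"
    using m by (simp add: distrib_right mom0_def mom1_def)
  then have "x * mom0 f + mom1 f = (LBINT y. (x + y) * half_line f y)"
    by (simp only: set_lebesgue_integral_def eq)
  moreover have "integrable lborel (\<lambda>y. (x + y) * half_line f y)"
    using i unfolding set_integrable_def eq .
  moreover have "(x + y) * half_line f y \<ge> 0" for y
    using nonneg assms by (auto simp: half_line_def indicator_def)
  ultimately show ?thesis by (subst nn_integral_eq_integral) auto
qed

context
  fixes \<phi> :: "real \<Rightarrow> real"
  assumes \<phi> [measurable]: "\<phi> \<in> borel_measurable borel" and \<phi>_nonneg: "\<And>x. \<phi> x \<ge> 0"
begin

lemma pair_integral_gain: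
  assumes i: "set_integrable lborel {0..} (\<lambda>x. \<phi> x * (x / 2 * conv f f x))"
  shows "ennreal (2 * (LBINT x:{0..}. \<phi> x * (x / 2 * conv f f x))) = pair_integral f (\<lambda>x y. \<phi> (x + y))"
proof -
  have conv_nonneg: "conv f f x \<ge> 0" for x
    unfolding conv_def set_lebesgue_integral_def
    by (rule Bochner_Integration.integral_nonneg) (auto simp: indicator_def nonneg)
  let ?g = "\<lambda>x. indicator {0..} x * (2 * (\<phi> x * (x / 2 * conv f f x)))"
  have gi: "integrable lborel ?g"
  proof -
    have "set_integrable lborel {0..} (\<lambda>x. 2 * (\<phi> x * (x / 2 * conv f f x)))"
      by (intro set_integrable_mult_right i)
    then show ?thesis by (simp add: set_integrable_def)
  qed
  have "2 * (LBINT x:{0..}. \<phi> x * (x / 2 * conv f f x)) = (LBINT x:{0..}. 2 * (\<phi> x * (x / 2 * conv f f x)))"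
    by (rule set_integral_mult_right[symmetric])
  then have "ennreal (2 * (LBINT x:{0..}. \<phi> x * (x / 2 * conv f f x))) = ennreal (LBINT x. ?g x)"
    by (simp only: set_lebesgue_integral_def real_scaleR_def)
  also have "\<dots> = (\<integral>\<^sup>+x. ennreal (?g x) \<partial>lborel)"
  proof (rule nn_integral_eq_integral[symmetric, OF gi], intro AE_I2)
    fix x :: real
    have "0 \<le> 2 * (\<phi> x * (x / 2 * conv f f x))" if "x \<ge> 0"
      using \<phi>_nonneg conv_nonneg that by (intro mult_nonneg_nonneg) auto
    then show "0 \<le> ?g x" by (simp add: indicator_def)
  qed
  also have "\<dots> = (\<integral>\<^sup>+x. \<integral>\<^sup>+y. ennreal (\<phi> x * (x * (half_line f (x - y) * half_line f y))) \<partial>lborel \<partial>lborel)"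
  proof (rule nn_integral_cong)
    fix x :: real
    show "ennreal (?g x) = (\<integral>\<^sup>+y. ennreal (\<phi> x * (x * (half_line f (x - y) * half_line f y))) \<partial>lborel)"
    proof (cases "x \<ge> 0")
      case True
      have "?g x = (\<phi> x * x) * conv f f x" using True by simp
      then have "ennreal (?g x) = ennreal (\<phi> x * x) * ennreal (conv f f x)"
        using True \<phi>_nonneg conv_nonneg by (simp only: ennreal_mult mult_nonneg_nonneg)
      also have "\<dots> = (\<integral>\<^sup>+y. ennreal (\<phi> x * x) * ennreal (half_line f (x - y) * half_line f y) \<partial>lborel)"
        unfolding ennreal_conv[OF True] by (rule nn_integral_cmult[symmetric]) measurable
      also have "\<dots> = (\<integral>\<^sup>+y. ennreal (\<phi> x * (x * (half_line f (x - y) * half_line f y))) \<partial>lborel)"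
      proof (rule nn_integral_cong)
        fix y
        have "ennreal (\<phi> x * x) * ennreal (half_line f (x - y) * half_line f y)
            = ennreal ((\<phi> x * x) * (half_line f (x - y) * half_line f y))"
          using True \<phi>_nonneg half_line_nonneg by (intro ennreal_mult[symmetric]) auto
        then show "ennreal (\<phi> x * x) * ennreal (half_line f (x - y) * half_line f y)
            = ennreal (\<phi> x * (x * (half_line f (x - y) * half_line f y)))"
          by (simp only: mult.assoc)
      qed
      finally show ?thesis .
    next
      case False
      then have "half_line f (x - y) * half_line f y = 0" for y
        by (auto simp: half_line_def indicator_def)
      then show ?thesis using False by (simp only:) simp
    qed
  qed
  also have "\<dots> = (\<integral>\<^sup>+y. \<integral>\<^sup>+x. ennreal (\<phi> x * (x * (half_line f (x - y) * half_line f y))) \<partial>lborel \<partial>lborel)"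
    by (rule lborel_pair.Fubini') measurable
  also have "\<dots> = (\<integral>\<^sup>+y. \<integral>\<^sup>+x. ennreal (\<phi> (y + x) * ((y + x) * (half_line f x * half_line f y))) \<partial>lborel \<partial>lborel)"
  proof (rule nn_integral_cong)
    fix y :: real
    show "(\<integral>\<^sup>+x. ennreal (\<phi> x * (x * (half_line f (x - y) * half_line f y))) \<partial>lborel)
       = (\<integral>\<^sup>+x. ennreal (\<phi> (y + x) * ((y + x) * (half_line f x * half_line f y))) \<partial>lborel)"
      by (subst nn_integral_real_affine[where c = 1 and t = y]) auto
  qed
  also have "\<dots> = pair_integral f (\<lambda>x y. \<phi> (x + y))"
    unfolding pair_integral_def by (simp add: mult.commute[of "half_line f _" "half_line f _"])
  finally show ?thesis .
qed

text \<open>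
  The loss term gives \<open>\<psi>(x, y) = 2 \<phi>(x)\<close>; since the kernel is symmetric this may be replaced by
  \<open>\<phi>(x) + \<phi>(y)\<close>.
\<close>

lemma pair_integral_loss:
  assumes i: "set_integrable lborel {0..} (\<lambda>x. \<phi> x * (f x * (x * mom0 f + mom1 f)))"
  shows "ennreal (2 * (LBINT x:{0..}. \<phi> x * (f x * (x * mom0 f + mom1 f))))
    = pair_integral f (\<lambda>x y. \<phi> x + \<phi> y)"
proof -
  have mom_nonneg: "mom0 f \<ge> 0" "mom1 f \<ge> 0"
    unfolding mom0_def mom1_def set_lebesgue_integral_def
    by (rule Bochner_Integration.integral_nonneg; auto simp: indicator_def nonneg)+
  let ?g = "\<lambda>x. indicator {0..} x * (\<phi> x * (f x * (x * mom0 f + mom1 f)))"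
  have nn: "0 \<le> (LBINT x:{0..}. \<phi> x * (f x * (x * mom0 f + mom1 f)))"
    unfolding set_lebesgue_integral_def
    by (rule Bochner_Integration.integral_nonneg) (auto simp: indicator_def mom_nonneg \<phi>_nonneg nonneg)
  have "ennreal (LBINT x:{0..}. \<phi> x * (f x * (x * mom0 f + mom1 f))) = ennreal (LBINT x. ?g x)"
    by (simp add: set_lebesgue_integral_def)
  also have "\<dots> = (\<integral>\<^sup>+x. ennreal (?g x) \<partial>lborel)"
    using i by (intro nn_integral_eq_integral[symmetric])
       (auto simp: indicator_def mom_nonneg \<phi>_nonneg nonneg set_integrable_def)
  also have "\<dots> = (\<integral>\<^sup>+x. \<integral>\<^sup>+y. ennreal (\<phi> x * ((x + y) * (half_line f x * half_line f y))) \<partial>lborel \<partial>lborel)"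
  proof (rule nn_integral_cong)
    fix x :: real
    show "ennreal (?g x) = (\<integral>\<^sup>+y. ennreal (\<phi> x * ((x + y) * (half_line f x * half_line f y))) \<partial>lborel)"
    proof (cases "x \<ge> 0")
      case True
      have fx: "half_line f x = f x" using True by (simp add: half_line_def)
      have pos: "(x + y) * half_line f y \<ge> 0" for y
        using nonneg True by (auto simp: half_line_def indicator_def)
      have "ennreal (?g x) = ennreal (\<phi> x * f x) * ennreal (x * mom0 f + mom1 f)"
        using True \<phi>_nonneg nonneg mom_nonneg by (simp add: ennreal_mult[symmetric] mult.assoc del: ennreal_plus)
      also have "\<dots> = (\<integral>\<^sup>+y. ennreal (\<phi> x * f x) * ennreal ((x + y) * half_line f y) \<partial>lborel)"
        unfolding ennreal_moments[OF True] by (rule nn_integral_cmult[symmetric]) measurable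
      also have "\<dots> = (\<integral>\<^sup>+y. ennreal (\<phi> x * ((x + y) * (half_line f x * half_line f y))) \<partial>lborel)"
      proof (rule nn_integral_cong)
        fix y
        have "ennreal (\<phi> x * f x) * ennreal ((x + y) * half_line f y) = ennreal ((\<phi> x * f x) * ((x + y) * half_line f y))"
          using True \<phi>_nonneg nonneg pos by (intro ennreal_mult[symmetric]) auto
        also have "(\<phi> x * f x) * ((x + y) * half_line f y) = \<phi> x * ((x + y) * (half_line f x * half_line f y))"
          by (simp add: fx)
        finally show "ennreal (\<phi> x * f x) * ennreal ((x + y) * half_line f y) = ennreal (\<phi> x * ((x + y) * (half_line f x * half_line f y)))" .
      qed
      finally show ?thesis .
    qed (simp add: half_line_def)
  qed
  finally have L: "ennreal (LBINT x:{0..}. \<phi> x * (f x * (x * mom0 f + mom1 f))) = pair_integral f (\<lambda>x y. \<phi> x)"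
    by (simp add: pair_integral_def)
  have "pair_integral f (\<lambda>x y. \<phi> x) = (\<integral>\<^sup>+y. \<integral>\<^sup>+x. ennreal (\<phi> x * ((x + y) * (half_line f x * half_line f y))) \<partial>lborel \<partial>lborel)"
    unfolding pair_integral_def by (rule lborel_pair.Fubini') measurable
  also have "\<dots> = pair_integral f (\<lambda>x y. \<phi> y)"
    unfolding pair_integral_def by (simp add: mult.commute[of "half_line f _" "half_line f _"] add.commute)
  finally have sw: "pair_integral f (\<lambda>x y. \<phi> x) = pair_integral f (\<lambda>x y. \<phi> y)" .
  have "pair_integral f (\<lambda>x y. \<phi> x + \<phi> y) = pair_integral f (\<lambda>x y. \<phi> x) + pair_integral f (\<lambda>x y. \<phi> y)"
  proof -
    have pos: "0 \<le> (x + y) * (half_line f x * half_line f y)" for x y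
      using nonneg by (auto simp: half_line_def indicator_def)
    have "pair_integral f (\<lambda>x y. \<phi> x + \<phi> y) = (\<integral>\<^sup>+x. \<integral>\<^sup>+y. ennreal (\<phi> x * ((x + y) * (half_line f x * half_line f y)))
        + ennreal (\<phi> y * ((x + y) * (half_line f x * half_line f y))) \<partial>lborel \<partial>lborel)"
      unfolding pair_integral_def distrib_right
      by (intro nn_integral_cong) (simp add: ennreal_plus[symmetric] pos \<phi>_nonneg distrib_right[symmetric] del: ennreal_plus)
    also have "\<dots> = pair_integral f (\<lambda>x y. \<phi> x) + pair_integral f (\<lambda>x y. \<phi> y)"
      unfolding pair_integral_def
      by (rule nn_integral_add_pair[symmetric]) measurable
    finally show ?thesis .
  qed
  also have "\<dots> = ennreal (2 * (LBINT x:{0..}. \<phi> x * (f x * (x * mom0 f + mom1 f))))"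
    unfolding sw[symmetric] L[symmetric] mult_2 by (rule ennreal_plus[OF nn nn, symmetric])
  finally show ?thesis ..
qed

lemma weak_form_split:
  assumes g: "set_integrable lborel {0..} (\<lambda>x. \<phi> x * (x / 2 * conv f f x))"
    and l: "set_integrable lborel {0..} (\<lambda>x. \<phi> x * (f x * (x * mom0 f + mom1 f)))"
  shows "(LBINT x:{0..}. \<phi> x * coag_form f f x) = (LBINT x:{0..}. \<phi> x * (x / 2 * conv f f x))
     - (LBINT x:{0..}. \<phi> x * (f x * (x * mom0 f + mom1 f)))"
  by (subst set_integral_diff(2)[OF g l, symmetric]) (simp add: coag_form_def right_diff_distrib)

text \<open>
  Used with \<open>\<phi>(x) = x\<close>: coagulation conserves volume.
\<close>

lemma weak_form_additive:
  assumes g: "set_integrable lborel {0..} (\<lambda>x. \<phi> x * (x / 2 * conv f f x))"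
    and l: "set_integrable lborel {0..} (\<lambda>x. \<phi> x * (f x * (x * mom0 f + mom1 f)))"
    and add: "\<And>x y. x \<ge> 0 \<Longrightarrow> y \<ge> 0 \<Longrightarrow> \<phi> (x + y) = \<phi> x + \<phi> y"
  shows "(LBINT x:{0..}. \<phi> x * coag_form f f x) = 0"
proof -
  have conv_nonneg: "conv f f x \<ge> 0" for x
    unfolding conv_def set_lebesgue_integral_def
    by (rule Bochner_Integration.integral_nonneg) (auto simp: indicator_def nonneg)
  have mom_nonneg: "mom0 f \<ge> 0" "mom1 f \<ge> 0"
    unfolding mom0_def mom1_def set_lebesgue_integral_def
    by (rule Bochner_Integration.integral_nonneg; auto simp: indicator_def nonneg)+
  have "pair_integral f (\<lambda>x y. \<phi> (x + y)) = pair_integral f (\<lambda>x y. \<phi> x + \<phi> y)"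
    unfolding pair_integral_def
  proof (intro nn_integral_cong)
    fix x y :: real
    show "ennreal (\<phi> (x + y) * ((x + y) * (half_line f x * half_line f y)))
      = ennreal ((\<phi> x + \<phi> y) * ((x + y) * (half_line f x * half_line f y)))"
      by (cases "x \<ge> 0 \<and> y \<ge> 0") (auto simp: add half_line_def)
  qed
  from trans[OF pair_integral_gain[OF g] trans[OF this pair_integral_loss[OF l, symmetric]]]
  have "ennreal (2 * (LBINT x:{0..}. \<phi> x * (x / 2 * conv f f x)))
     = ennreal (2 * (LBINT x:{0..}. \<phi> x * (f x * (x * mom0 f + mom1 f))))" .
  moreover have "0 \<le> (LBINT x:{0..}. \<phi> x * (x / 2 * conv f f x))"
    unfolding set_lebesgue_integral_def
    by (rule Bochner_Integration.integral_nonneg) (auto simp: indicator_def \<phi>_nonneg conv_nonneg)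
  moreover have "0 \<le> (LBINT x:{0..}. \<phi> x * (f x * (x * mom0 f + mom1 f)))"
    unfolding set_lebesgue_integral_def
    by (rule Bochner_Integration.integral_nonneg) (auto simp: indicator_def mom_nonneg \<phi>_nonneg nonneg)
  ultimately show ?thesis unfolding weak_form_split[OF g l] by (simp add: ennreal_inj)
qed

text \<open>
  Every superadditive test function gains under coagulation. The strict part of the
  superadditivity, \<open>\<kappa>\<close> on a square, gives a quantitative gain.
\<close>

lemma weak_form_superadditive:
  assumes g: "set_integrable lborel {0..} (\<lambda>x. \<phi> x * (x / 2 * conv f f x))"
    and l: "set_integrable lborel {0..} (\<lambda>x. \<phi> x * (f x * (x * mom0 f + mom1 f)))"
    and \<kappa>: "\<kappa> \<ge> 0" and u: "0 \<le> u" "u \<le> v" and m: "m \<ge> 0" "\<And>x. u \<le> x \<Longrightarrow> x < v \<Longrightarrow> m \<le> f x"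
    and super: "\<And>x y. x \<ge> 0 \<Longrightarrow> y \<ge> 0 \<Longrightarrow>
       \<phi> x + \<phi> y + \<kappa> * indicator {u..<v} x * indicator {u..<v} y \<le> \<phi> (x + y)"
  shows "\<kappa> * u * m\<^sup>2 * (v - u)\<^sup>2 \<le> (LBINT x:{0..}. \<phi> x * coag_form f f x)"
proof -
  have conv_nonneg: "conv f f x \<ge> 0" for x
    unfolding conv_def set_lebesgue_integral_def
    by (rule Bochner_Integration.integral_nonneg) (auto simp: indicator_def nonneg)
  define G L where "G = (LBINT x:{0..}. \<phi> x * (x / 2 * conv f f x))"
    and "L = (LBINT x:{0..}. \<phi> x * (f x * (x * mom0 f + mom1 f)))"
  have G: "0 \<le> G"
    unfolding set_lebesgue_integral_def G_def
    by (rule Bochner_Integration.integral_nonneg) (auto simp: indicator_def \<phi>_nonneg conv_nonneg)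
  have mom_nonneg: "mom0 f \<ge> 0" "mom1 f \<ge> 0"
    unfolding mom0_def mom1_def set_lebesgue_integral_def
    by (rule Bochner_Integration.integral_nonneg; auto simp: indicator_def nonneg)+
  have L: "0 \<le> L"
    unfolding set_lebesgue_integral_def L_def
    by (rule Bochner_Integration.integral_nonneg) (auto simp: indicator_def mom_nonneg \<phi>_nonneg nonneg)
  define k where "k = \<kappa> * (2 * u * m\<^sup>2)"
  have k: "k \<ge> 0" using \<kappa> u by (simp add: k_def)
  have "ennreal (2 * L + k * (v - u)\<^sup>2) = ennreal (2 * L) + ennreal (k * (v - u)\<^sup>2)"
    using L k by (intro ennreal_plus) auto
  also have "ennreal (k * (v - u)\<^sup>2) = (\<integral>\<^sup>+x. \<integral>\<^sup>+y. ennreal k * (indicator {u..<v} x * indicator {u..<v} y) \<partial>lborel \<partial>lborel)"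
    using u k by (simp add: nn_integral_cmult nn_integral_multc power2_eq_square ennreal_mult)
  also have "ennreal (2 * L) = pair_integral f (\<lambda>x y. \<phi> x + \<phi> y)"
    unfolding L_def by (rule pair_integral_loss[OF l])
  also have "pair_integral f (\<lambda>x y. \<phi> x + \<phi> y) + (\<integral>\<^sup>+x. \<integral>\<^sup>+y. ennreal k * (indicator {u..<v} x * indicator {u..<v} y) \<partial>lborel \<partial>lborel)
     = (\<integral>\<^sup>+x. \<integral>\<^sup>+y. ennreal ((\<phi> x + \<phi> y) * ((x + y) * (half_line f x * half_line f y)))
          + ennreal k * (indicator {u..<v} x * indicator {u..<v} y) \<partial>lborel \<partial>lborel)"
    unfolding pair_integral_def
    by (rule nn_integral_add_pair) measurable
  also have "\<dots> \<le> pair_integral f (\<lambda>x y. \<phi> (x + y))"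
    unfolding pair_integral_def
  proof (intro nn_integral_mono)
    fix x y :: real
    let ?w = "(x + y) * (half_line f x * half_line f y)"
    show "ennreal ((\<phi> x + \<phi> y) * ?w) + ennreal k * (indicator {u..<v} x * indicator {u..<v} y) \<le> ennreal (\<phi> (x + y) * ?w)"
    proof (cases "x \<ge> 0 \<and> y \<ge> 0")
      case True
      have w: "?w = (x + y) * (f x * f y)" using True by (simp add: half_line_def)
      have w0: "?w \<ge> 0" unfolding w using True nonneg by auto
      have kw: "k * (indicator {u..<v} x * indicator {u..<v} y) \<le> \<kappa> * indicator {u..<v} x * indicator {u..<v} y * ?w"
      proof (cases "x \<in> {u..<v} \<and> y \<in> {u..<v}")
        case T: True
        then have "2 * u * m\<^sup>2 \<le> (x + y) * (f x * f y)"
          unfolding power2_eq_square using u m True nonneg by (intro mult_mono) auto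
        then have "\<kappa> * (2 * u * m\<^sup>2) \<le> \<kappa> * ((x + y) * (f x * f y))"
          using \<kappa> by (rule mult_left_mono)
        then show ?thesis unfolding w using T by (simp add: k_def)
      qed (auto simp: indicator_def)
      have "ennreal ((\<phi> x + \<phi> y) * ?w) + ennreal k * (indicator {u..<v} x * indicator {u..<v} y)
         = ennreal ((\<phi> x + \<phi> y) * ?w) + ennreal (k * (indicator {u..<v} x * indicator {u..<v} y))"
        by (simp add: indicator_def)
      also have "\<dots> = ennreal ((\<phi> x + \<phi> y) * ?w + k * (indicator {u..<v} x * indicator {u..<v} y))"
        using \<phi>_nonneg w0 k by (intro ennreal_plus[symmetric]) auto
      also have "\<dots> \<le> ennreal (\<phi> (x + y) * ?w)"
      proof (rule ennreal_leI)
        have "(\<phi> x + \<phi> y) * ?w + k * (indicator {u..<v} x * indicator {u..<v} y)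
           \<le> (\<phi> x + \<phi> y + \<kappa> * indicator {u..<v} x * indicator {u..<v} y) * ?w"
          using kw by (simp add: distrib_right)
        also have "\<dots> \<le> \<phi> (x + y) * ?w"
          using True w0 by (intro mult_right_mono super) auto
        finally show "(\<phi> x + \<phi> y) * ?w + k * (indicator {u..<v} x * indicator {u..<v} y) \<le> \<phi> (x + y) * ?w" .
      qed
      finally show ?thesis .
    next
      case False
      then have "?w = 0" by (auto simp: half_line_def)
      then show ?thesis using False u by (auto simp: indicator_def)
    qed
  qed
  also have "\<dots> = ennreal (2 * G)"
    unfolding G_def by (rule pair_integral_gain[OF g, symmetric])
  finally have "2 * L + k * (v - u)\<^sup>2 \<le> 2 * G" using G by (simp add: ennreal_le_iff)
  then have "\<kappa> * u * m\<^sup>2 * (v - u)\<^sup>2 \<le> G - L" by (simp add: k_def)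
  then show ?thesis unfolding weak_form_split[OF g l] G_def L_def .
qed

end

end

section \<open>Integrating factor of a drift with a far field\<close>

lemma continuous_on_atLeast_if_atLeastAtMost:
  fixes g :: "real \<Rightarrow> real"
  assumes "\<And>R. R \<ge> 0 \<Longrightarrow> continuous_on {0..R} g"
  shows "continuous_on {0..} g"
proof -
  have "continuous (at x within {0..}) g" if "x \<ge> 0" for x
  proof -
    have "continuous (at x within {0..x + 1}) g"
      using assms[of "x + 1"] that by (auto simp: continuous_on_eq_continuous_within)
    moreover have "at x within {0..x + 1} = at x within {0..}"
      by (rule at_within_nhd[of _ "{..<x + 1}"]) auto
    ultimately show ?thesis by simp
  qed
  then show ?thesis by (auto simp: continuous_on_eq_continuous_within)
qed

text \<open>
  The properties of \<open>a(z) = z + 1 - \<lambda> z\<^sup>1\<^sup>/\<^sup>3\<close> that the construction uses: \<open>\<alpha>\<close> bounds it from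
  below even in the bottleneck, which lies between \<open>z\<^sub>1\<close> and \<open>z\<^sub>0\<close>. The condition \<open>z\<^sub>0/2 < z\<^sub>1\<close> lets
  two sizes in front of the bottleneck coagulate to one beyond it.
\<close>

locale drift =
  fixes a :: "real \<Rightarrow> real" and \<alpha> c\<^sub>0 z\<^sub>0 z\<^sub>1 :: real
  assumes a_cont: "continuous_on {0..} a"
    and \<alpha>: "0 < \<alpha>" "\<alpha> \<le> 1"
    and a_ge: "\<And>x. x \<ge> 0 \<Longrightarrow> \<alpha> \<le> a x"
    and c\<^sub>0: "0 < c\<^sub>0"
    and a_far: "\<And>x. x \<ge> z\<^sub>0 \<Longrightarrow> c\<^sub>0 * (1 + x) \<le> a x"
    and z: "0 < z\<^sub>0" "z\<^sub>0 \<le> 1" "z\<^sub>0 / 2 < z\<^sub>1" "z\<^sub>1 < z\<^sub>0"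
    and a_le: "\<And>x. x \<ge> z\<^sub>1 \<Longrightarrow> a x \<le> x"
begin

definition P :: "real \<Rightarrow> real" where
  "P x = exp (integral {0..x} (\<lambda>y. 1 / a y))"

lemma a_pos: "x \<ge> 0 \<Longrightarrow> 0 < a x"
  using a_ge[of x] \<alpha> by simp

lemma a_nonneg: "x \<ge> 0 \<Longrightarrow> 0 \<le> a x"
  using a_pos[of x] by simp

lemma inverse_a_cont: "continuous_on {0..} (\<lambda>y. 1 / a y)"
  using a_pos by (intro continuous_intros a_cont) (auto simp: less_imp_neq[symmetric])

lemma inverse_a_integrable: "0 \<le> x \<Longrightarrow> (\<lambda>y. 1 / a y) integrable_on {x..y}"
  by (intro integrable_continuous_real continuous_on_subset[OF inverse_a_cont]) auto

lemma P_pos: "0 < P x"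
  by (simp add: P_def)

lemma P_nonneg: "0 \<le> P x"
  by (simp add: P_def)

lemma P_0: "P 0 = 1"
  by (simp add: P_def)

lemma P_split: "0 \<le> x \<Longrightarrow> x \<le> y \<Longrightarrow> P y = P x * exp (integral {x..y} (\<lambda>y. 1 / a y))"
  unfolding P_def exp_add[symmetric]
  by (subst Henstock_Kurzweil_Integration.integral_combine) (auto intro: inverse_a_integrable)

lemma P_mono: assumes "0 \<le> x" "x \<le> y" shows "P x \<le> P y"
proof -
  have "0 \<le> integral {x..y} (\<lambda>y. 1 / a y)"
    using assms by (intro Henstock_Kurzweil_Integration.integral_nonneg inverse_a_integrable) (auto simp: a_nonneg)
  then show ?thesis unfolding P_split[OF assms] using P_pos[of x] by (simp add: mult_le_cancel_left1)
qed

lemma P_ge_1: "0 \<le> x \<Longrightarrow> 1 \<le> P x"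
  using P_mono[of 0 x] by (simp add: P_0)

lemma P_ge_exp:
  assumes "0 \<le> x" "x \<le> y" "\<And>t. x \<le> t \<Longrightarrow> t \<le> y \<Longrightarrow> a t \<le> M"
  shows "P x * exp ((y - x) / M) \<le> P y"
proof -
  have "integral {x..y} (\<lambda>y. 1 / M) \<le> integral {x..y} (\<lambda>y. 1 / a y)"
    using assms a_pos by (intro integral_le inverse_a_integrable) (auto intro!: divide_left_mono mult_pos_pos less_le_trans[OF a_pos assms(3)])
  then have "(y - x) / M \<le> integral {x..y} (\<lambda>y. 1 / a y)" using assms by simp
  then show ?thesis unfolding P_split[OF assms(1,2)] using P_pos[of x] by (intro mult_left_mono) auto
qed

lemma P_le_exp:
  assumes "0 < m" "0 \<le> x" "x \<le> y" "\<And>t. x \<le> t \<Longrightarrow> t \<le> y \<Longrightarrow> m \<le> a t"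
  shows "P y \<le> P x * exp ((y - x) / m)"
proof -
  have "integral {x..y} (\<lambda>y. 1 / a y) \<le> integral {x..y} (\<lambda>y. 1 / m)"
    using assms a_pos by (intro integral_le inverse_a_integrable) (auto intro!: divide_left_mono mult_pos_pos less_le_trans[OF assms(1) assms(4)])
  then have "integral {x..y} (\<lambda>y. 1 / a y) \<le> (y - x) / m" using assms by simp
  then show ?thesis unfolding P_split[OF assms(2,3)] using P_pos[of x] by (intro mult_left_mono) auto
qed

lemma P_growth: assumes "z\<^sub>0 \<le> x" "x \<le> y" shows "P y \<le> P x * exp ((y - x) / c\<^sub>0)"
proof (rule P_le_exp[OF c\<^sub>0])
  show "0 \<le> x" "x \<le> y" using assms z by auto
  fix t assume t: "x \<le> t"
  then have "c\<^sub>0 * 1 \<le> c\<^sub>0 * (1 + t)" using assms z c\<^sub>0 by (intro mult_left_mono) auto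
  also have "\<dots> \<le> a t" using t assms by (intro a_far) auto
  finally show "c\<^sub>0 \<le> a t" by simp
qed

text \<open>
  The logarithmic derivative of \<open>P(x)/x\<close> is \<open>1/a(x) - 1/x \<ge> 0\<close>. This is the source of all
  positivity: it makes \<open>P\<close>, cut off below some \<open>z \<ge> z\<^sub>1\<close>, superadditive.
\<close>

lemma P_ratio_mono: assumes "z\<^sub>1 \<le> x" "x \<le> y" shows "P x / x \<le> P y / y"
proof -
  have x: "0 < x" using assms z by simp
  have i: "((\<lambda>t. 1 / t) has_integral (ln y - ln x)) {x..y}"
    using x assms by (intro fundamental_theorem_of_calculus)
      (auto intro!: derivative_eq_intros simp: has_real_derivative_iff_has_vector_derivative[symmetric])
  have "ln y - ln x \<le> integral {x..y} (\<lambda>y. 1 / a y)"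
  proof -
    have "integral {x..y} (\<lambda>t. 1 / t) \<le> integral {x..y} (\<lambda>y. 1 / a y)"
    proof (rule integral_le)
      fix t assume t: "t \<in> {x..y}"
      then show "1 / t \<le> 1 / a t"
        using a_le[of t] a_pos[of t] assms x by (intro divide_left_mono) auto
    qed (use i x inverse_a_integrable in auto)
    then show ?thesis using i by (simp add: integral_unique)
  qed
  then have "exp (ln y - ln x) \<le> exp (integral {x..y} (\<lambda>y. 1 / a y))" by simp
  then have "y / x \<le> exp (integral {x..y} (\<lambda>y. 1 / a y))"
    using x assms by (simp add: exp_diff)
  then have "P x * (y / x) \<le> P y"
    unfolding P_split[OF less_imp_le[OF x] assms(2)] using P_pos[of x] by (intro mult_left_mono) auto
  then show ?thesis using x assms by (simp add: field_simps)
qed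

lemma P_deriv: assumes "0 \<le> x" shows "(P has_real_derivative P x / a x) (at x within {0..})"
proof -
  have "((\<lambda>x. integral {0..x} (\<lambda>y. 1 / a y)) has_real_derivative 1 / a x) (at x within {0..x + 1})"
    using assms by (intro integral_has_real_derivative continuous_on_subset[OF inverse_a_cont]) auto
  then have "(P has_real_derivative exp (integral {0..x} (\<lambda>y. 1 / a y)) * (1 / a x)) (at x within {0..x + 1})"
    unfolding P_def by (auto intro!: derivative_eq_intros)
  moreover have "at x within {0..x + 1} = at x within {0..}"
    by (rule at_within_nhd[of _ "{..<x + 1}"]) auto
  ultimately show ?thesis by (simp add: P_def)
qed

lemma P_cont: "continuous_on {0..} P"
  using P_deriv by (auto intro!: DERIV_continuous_on)

end

section \<open>The normalised source map\<close>

text \<open>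
  The number \<open>h\<close> bounds the coagulation-free profile \<open>1/(a P)\<close> from below in front of the
  bottleneck, \<open>\<tau>\<close> is the size of the tail in units of \<open>weight b\<close>, and \<open>c P(z\<^sub>0)\<close> will be the lower
  bound for the normalising factor \<open>q\<close>. The last four conditions say that \<open>P(z\<^sub>0)\<close> is huge. In turn
  they guarantee that \<open>step\<close> stays close to the profile on \<open>[0, z\<^sub>0]\<close>, that it keeps the tail below
  \<open>\<tau> weight b\<close>, and that it contracts on \<open>[0, z\<^sub>0]\<close> and in the tail. They are compatible because
  \<open>E\<^sup>2\<close> may be a small multiple of \<open>P(z\<^sub>0)\<close>.
\<close>

locale barrier = drift +
  fixes h \<tau> b c E :: real
  assumes h: "0 < h" "h \<le> 1"
    and near: "\<And>x. 0 \<le> x \<Longrightarrow> x \<le> z\<^sub>1 \<Longrightarrow> h \<le> 1 / (a x * P x)"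
    and b: "2 \<le> b" "1 / c\<^sub>0 + 1 \<le> b"
    and E: "E = exp (b * z\<^sub>0)"
    and c: "c = z\<^sub>0 * h\<^sup>2 * (z\<^sub>1 - z\<^sub>0 / 2)\<^sup>2 / 16"
    and \<tau>: "0 < \<tau>" "520 * \<tau> \<le> \<alpha> * c"
    and C1: "200 \<le> c * \<alpha>^3 * h * P z\<^sub>0"
    and C2: "320 * E\<^sup>2 \<le> \<tau> * \<alpha>\<^sup>2 * c * c\<^sub>0 * P z\<^sub>0"
    and C3: "200000 * E \<le> c\<^sup>2 * \<alpha>^4 * P z\<^sub>0"
    and C4: "320 * E \<le> \<alpha> * c * c\<^sub>0 * P z\<^sub>0"
begin

lemma c_bounds: "0 < c" "c \<le> 1"
proof -
  show "0 < c" using z h by (simp add: c)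
  have "h\<^sup>2 \<le> 1" "(z\<^sub>1 - z\<^sub>0 / 2)\<^sup>2 \<le> 1" using z h by (auto intro!: power_le_one)
  then have "z\<^sub>0 * h\<^sup>2 * (z\<^sub>1 - z\<^sub>0 / 2)\<^sup>2 \<le> 1 * 1 * 1"
    using z h by (intro mult_mono) auto
  then show "c \<le> 1" by (simp add: c)
qed

lemma E_ge_1: "1 \<le> E" using b z by (simp add: E)

lemma \<tau>_le_1: "\<tau> \<le> 1"
proof -
  have "\<alpha> * c \<le> 1 * 1" using \<alpha> c_bounds by (intro mult_mono) auto
  then show ?thesis using \<tau> by linarith
qed

text \<open>
  Beyond \<open>z\<^sub>0\<close>, \<open>P\<close> grows at most like \<open>exp (x / c\<^sub>0)\<close>, and \<open>b \<ge> 1/c\<^sub>0 + 1\<close> leaves a full unit of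
  exponential decay. So the tail integral has the size of its integrand at the left end.
\<close>

lemma P_integrable:
  assumes "continuous_on {0..} g" "\<And>x. x \<ge> 0 \<Longrightarrow> \<bar>g x\<bar> \<le> C * (exp (- b * x) / (1 + x))"
  shows "set_integrable lborel {0..} (\<lambda>x. P x * g x)"
    and "\<And>z. z\<^sub>0 \<le> z \<Longrightarrow> \<bar>LBINT x:{z..}. P x * g x\<bar> \<le> P z * (C * (exp (- b * z) / (1 + z)))"
proof -
  have "\<bar>g 0\<bar> \<le> C" using assms(2)[of 0] by simp
  then have C: "0 \<le> C" by simp
  \<comment> \<open>rate of decay that is left after the growth of \<open>P\<close>\<close>
  define d where "d = b - 1 / c\<^sub>0"
  have d: "1 \<le> d" using b by (simp add: d_def)
  have *: "set_integrable lborel {z..} (\<lambda>x. P x * g x)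
     \<and> \<bar>LBINT x:{z..}. P x * g x\<bar> \<le> P z * (C * (exp (- b * z) / (1 + z)))" if zz: "z\<^sub>0 \<le> z" for z
  proof -
    have z0: "0 \<le> z" using zz z by simp
    define K where "K = P z * exp (- z / c\<^sub>0) * (C / (1 + z))"
    have K: "0 \<le> K" using P_pos[of z] C z0 by (simp add: K_def)
    have cont: "continuous_on {z..} (\<lambda>x. P x * g x)"
      using z0 by (intro continuous_intros continuous_on_subset[OF P_cont] continuous_on_subset[OF assms(1)]) auto
    have bd: "\<bar>P x * g x\<bar> \<le> K * exp (- d * x)" if x: "x \<ge> z" for x
    proof -
      have "exp (- b * x) / (1 + x) \<le> exp (- b * x) / (1 + z)" using x z0 by (intro divide_left_mono) auto
      then have "C * (exp (- b * x) / (1 + x)) \<le> C * (exp (- b * x) / (1 + z))"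
        using C by (rule mult_left_mono)
      with assms(2)[of x] x z0 have g: "\<bar>g x\<bar> \<le> C * (exp (- b * x) / (1 + z))" by simp
      have "P x * \<bar>g x\<bar> \<le> (P z * exp ((x - z) / c\<^sub>0)) * (C * (exp (- b * x) / (1 + z)))"
        using P_growth[OF zz x] g P_pos[of z] by (intro mult_mono) auto
      also have "\<dots> = P z * (C / (1 + z)) * (exp ((x - z) / c\<^sub>0) * exp (- b * x))" by simp
      also have "exp ((x - z) / c\<^sub>0) * exp (- b * x) = exp (- z / c\<^sub>0) * exp (- d * x)"
        unfolding mult_exp_exp by (simp add: d_def diff_divide_distrib left_diff_distrib)
      also have "P z * (C / (1 + z)) * (exp (- z / c\<^sub>0) * exp (- d * x)) = K * exp (- d * x)"
        by (simp add: K_def)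
      finally show ?thesis using P_pos[of x] by (simp add: abs_mult)
    qed
    note i = exp_dominated_integral[OF cont bd]
    have "K * exp (- d * z) / d \<le> K * exp (- d * z)"
      using d mult_left_mono[of 1 d "K * exp (- d * z)"] K by (simp add: divide_le_eq)
    also have "\<dots> = P z * (C / (1 + z)) * (exp (- z / c\<^sub>0) * exp (- d * z))" by (simp add: K_def)
    also have "exp (- z / c\<^sub>0) * exp (- d * z) = exp (- b * z)"
      unfolding mult_exp_exp by (simp add: d_def left_diff_distrib)
    also have "P z * (C / (1 + z)) * exp (- b * z) = P z * (C * (exp (- b * z) / (1 + z)))" by simp
    finally show ?thesis using i d by auto
  qed
  then show "\<And>z. z\<^sub>0 \<le> z \<Longrightarrow> \<bar>LBINT x:{z..}. P x * g x\<bar> \<le> P z * (C * (exp (- b * z) / (1 + z)))" by blast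
  have "set_integrable lborel ({0..z\<^sub>0} \<union> {z\<^sub>0..}) (\<lambda>x. P x * g x)"
    using * by (intro set_integrable_Un borel_integrable_atLeastAtMost' continuous_intros
      continuous_on_subset[OF P_cont] continuous_on_subset[OF assms(1)]) auto
  moreover have "{0..z\<^sub>0} \<union> {z\<^sub>0..} = {0..}" using z by auto
  ultimately show "set_integrable lborel {0..} (\<lambda>x. P x * g x)" by simp
qed

lemma P_integral_near:
  assumes "continuous_on {0..} g" "\<And>x. 0 \<le> x \<Longrightarrow> x \<le> z\<^sub>0 \<Longrightarrow> \<bar>g x\<bar> \<le> C" "0 \<le> z" "z \<le> z\<^sub>0"
  shows "\<bar>LBINT x:{0..z}. P x * g x\<bar> \<le> P z * C"
proof -
  have C: "0 \<le> C" using assms(2)[of 0] z by simp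
  have "\<bar>LBINT x:{0..z}. P x * g x\<bar> \<le> P z * C * (z - 0)"
  proof (rule compact_integral_bound)
    show "continuous_on {0..z} (\<lambda>x. P x * g x)"
      by (intro continuous_intros continuous_on_subset[OF P_cont] continuous_on_subset[OF assms(1)]) auto
    fix x assume "0 \<le> x" "x \<le> z"
    then show "\<bar>P x * g x\<bar> \<le> P z * C"
      unfolding abs_mult using P_mono[of x z] assms(2)[of x] P_pos[of x] P_pos[of z] assms(4) by (intro mult_mono) auto
  qed fact
  also have "\<dots> \<le> P z * C" using z assms C P_pos[of z] by (simp add: mult_left_le)
  finally show ?thesis .
qed

text \<open>
  The invariant set: bounded by \<open>2/\<alpha>\<close> up to \<open>z\<^sub>0\<close>, not small in front of the bottleneck, and tiny
  with exponential decay behind it. The lower bound keeps the normalising factor \<open>rate\<close> away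
  from zero.
\<close>

definition adm :: "(real \<Rightarrow> real) \<Rightarrow> bool" where
  "adm f \<longleftrightarrow> continuous_on {0..} f \<and> (\<forall>x\<ge>0. 0 \<le> f x) \<and> (\<forall>x. 0 \<le> x \<and> x \<le> z\<^sub>0 \<longrightarrow> f x \<le> 2 / \<alpha>)
     \<and> (\<forall>x. 0 \<le> x \<and> x \<le> z\<^sub>1 \<longrightarrow> h / 2 \<le> f x) \<and> (\<forall>x\<ge>z\<^sub>0. f x \<le> \<tau> * weight b x)"

definition rate :: "(real \<Rightarrow> real) \<Rightarrow> real" where
  "rate f = (LBINT x:{0..}. P x * coag_form f f x)"

definition step :: "(real \<Rightarrow> real) \<Rightarrow> real \<Rightarrow> real" where
  "step f z = (LBINT x:{z..}. P x * coag_form f f x) / (rate f * (a z * P z))"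

lemma quotient_bound:
  fixes N p X q Q k K :: real
  assumes "\<bar>N\<bar> \<le> p * X" "0 < p" "0 < Q" "Q \<le> q" "0 < K" "K \<le> k"
  shows "\<bar>N / (q * (k * p))\<bar> \<le> X / (Q * K)"
proof -
  have "0 \<le> p * X" using assms(1) by linarith
  then have X: "0 \<le> X" using assms(2) by (simp add: zero_le_mult_iff)
  have "\<bar>N / (q * (k * p))\<bar> = \<bar>N\<bar> / (q * (k * p))" using assms by (simp add: abs_mult)
  also have "\<dots> \<le> (p * X) / (q * (k * p))" using assms by (intro divide_right_mono) auto
  also have "\<dots> = X / (q * k)" using assms by simp
  also have "\<dots> \<le> X / (Q * K)" using assms X by (intro divide_left_mono mult_mono) auto
  finally show ?thesis .
qed

text \<open>
  Conversion between the sup norm on \<open>[0, z\<^sub>0]\<close> and the weighted norm, at the price of the factor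
  \<open>4 E\<close>.
\<close>

lemma weight_near: assumes "0 \<le> x" "x \<le> z\<^sub>0" shows "1 \<le> 4 * E * weight b x"
proof -
  have "(1 + x)\<^sup>2 \<le> 2\<^sup>2" using assms z by (intro power_mono) auto
  moreover have "1 \<le> E * exp (- b * x)" 
    unfolding E mult_exp_exp using assms b by (simp add: mult_left_mono)
  ultimately have "(1 + x)\<^sup>2 \<le> 4 * (E * exp (- b * x))" by simp
  moreover have "0 < (1 + x)\<^sup>2" using assms by simp
  ultimately show ?thesis by (simp add: weight_def field_simps)
qed

lemma weight_le_1: "0 \<le> x \<Longrightarrow> weight b x \<le> 1"
  using weight_le_exp[of x b] b by (simp add: order_trans[of _ "exp (- b * x)"])

context
  fixes f assumes f: "adm f"
begin

lemma adm_cont: "continuous_on {0..} f" and adm_nonneg: "x \<ge> 0 \<Longrightarrow> 0 \<le> f x"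
  and adm_near: "0 \<le> x \<Longrightarrow> x \<le> z\<^sub>0 \<Longrightarrow> f x \<le> 2 / \<alpha>"
  and adm_lower: "0 \<le> x \<Longrightarrow> x \<le> z\<^sub>1 \<Longrightarrow> h / 2 \<le> f x"
  and adm_far: "x \<ge> z\<^sub>0 \<Longrightarrow> f x \<le> \<tau> * weight b x"
  using f by (auto simp: adm_def)

lemma adm_dominated: "dominated b (8 * E / \<alpha>) f"
  unfolding dominated_def
proof (intro conjI allI impI adm_cont)
  fix x :: real assume x: "x \<ge> 0"
  have w: "0 < weight b x" by (rule weight_pos[OF x])
  have "f x \<le> 8 * E / \<alpha> * weight b x"
  proof (cases "x \<le> z\<^sub>0")
    case True
    have "f x \<le> 2 / \<alpha> * 1" using adm_near[OF x True] by simp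
    also have "\<dots> \<le> 2 / \<alpha> * (4 * E * weight b x)"
      using \<alpha> by (intro mult_left_mono weight_near x True) auto
    finally show ?thesis by simp
  next
    case False
    have "\<tau> \<le> 8 * E / \<alpha>"
    proof -
      have "1 * 1 \<le> 8 * E" using E_ge_1 by simp
      then have "\<alpha> \<le> 8 * E" using \<alpha> by simp
      then have "1 \<le> 8 * E / \<alpha>" using \<alpha> by simp
      then show ?thesis using \<tau>_le_1 by simp
    qed
    then show ?thesis using adm_far[of x] False w by (meson less_imp_le mult_right_mono not_le_imp_less order_trans)
  qed
  then show "\<bar>f x\<bar> \<le> 8 * E / \<alpha> * weight b x" using adm_nonneg[OF x] by simp
qed

text \<open>
  The weighted bound would give moments of order \<open>E/\<alpha>\<close>. Since the part of size \<open>1/\<alpha>\<close> lives on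
  \<open>[0, z\<^sub>0]\<close> with \<open>z\<^sub>0 \<le> 1\<close>, a comparison with \<open>20/\<alpha> exp (- 2 x)\<close> is both uniform and free of \<open>E\<close>.
\<close>

lemma adm_moments: "\<bar>mom0 f\<bar> \<le> 20 / \<alpha>" "\<bar>mom1 f\<bar> \<le> 20 / \<alpha>"
proof -
  have e2: "exp (2::real) \<le> 9"
  proof -
    have "exp (2::real) = exp 1 * exp 1" by (simp add: exp_add[symmetric])
    also have "\<dots> \<le> 3 * 3" using exp_le by (intro mult_mono) auto
    finally show ?thesis by simp
  qed
  have A: "1 \<le> 1 / \<alpha>" using \<alpha> by simp
  have bd: "\<bar>f x\<bar> \<le> 20 / \<alpha> * exp (- 2 * x)" if x: "x \<ge> 0" for x
  proof (cases "x \<le> z\<^sub>0")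
    case True
    have "1 \<le> exp (2 - 2 * x)" using True z by simp
    also have "\<dots> \<le> 9 * exp (- 2 * x)" using e2 by (simp add: exp_diff exp_minus field_simps)
    finally have 1: "1 \<le> 9 * exp (- 2 * x)" .
    have "f x \<le> 2 / \<alpha> * 1" using adm_near[OF x True] by simp
    also have "\<dots> \<le> 2 / \<alpha> * (9 * exp (- 2 * x))" using \<alpha> 1 by (intro mult_left_mono) auto
    also have "\<dots> \<le> 20 / \<alpha> * exp (- 2 * x)" using \<alpha> by (simp add: divide_right_mono)
    finally show ?thesis using adm_nonneg[OF x] by simp
  next
    case False
    have "f x \<le> \<tau> * weight b x" using False by (intro adm_far) auto
    also have "\<dots> \<le> 20 / \<alpha> * exp (- 2 * x)"
    proof (rule mult_mono)
      show "\<tau> \<le> 20 / \<alpha>" using \<tau>_le_1 A by simp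
      have "weight b x \<le> exp (- b * x)" by (rule weight_le_exp[OF x])
      also have "\<dots> \<le> exp (- 2 * x)" using b x by (simp add: mult_right_mono)
      finally show "weight b x \<le> exp (- 2 * x)" .
    qed (use \<alpha> weight_pos[OF x] in \<open>auto intro: less_imp_le\<close>)
    finally show ?thesis using adm_nonneg[OF x] by simp
  qed
  have bd1: "\<bar>f x\<bar> \<le> 20 / \<alpha> * exp (- 1 * x)" if x: "x \<ge> 0" for x
    by (rule order_trans[OF bd[OF x]]) (use \<alpha> x in \<open>auto intro!: divide_right_mono\<close>)
  have bd2: "\<bar>x * f x\<bar> \<le> 20 / \<alpha> * exp (- 1 * x)" if x: "x \<ge> 0" for x
  proof -
    have "x \<le> exp x" using exp_ge_add_one_self[of x] by linarith
    then have "x * \<bar>f x\<bar> \<le> exp x * (20 / \<alpha> * exp (- 2 * x))" using bd[OF x] x by (intro mult_mono) auto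
    also have "\<dots> = 20 / \<alpha> * (exp x * exp (- 2 * x))" by simp
    also have "exp x * exp (- 2 * x) = exp (- 1 * x)" unfolding mult_exp_exp by simp
    finally show ?thesis using x by (simp add: abs_mult)
  qed
  have cont: "continuous_on {0..} (\<lambda>x. x * f x)" by (intro continuous_intros adm_cont)
  show "\<bar>mom0 f\<bar> \<le> 20 / \<alpha>" "\<bar>mom1 f\<bar> \<le> 20 / \<alpha>"
    using exp_dominated_integral(2)[OF adm_cont bd1] exp_dominated_integral(2)[OF cont bd2]
    by (auto simp: mom0_def mom1_def)
qed

lemma adm_J_cont: "continuous_on {0..} (coag_form f f)"
  by (rule continuous_on_coag_form[OF adm_cont adm_cont])

lemma adm_J_near: assumes "0 \<le> x" "x \<le> z\<^sub>0" shows "\<bar>coag_form f f x\<bar> \<le> 100 / \<alpha>\<^sup>2"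
proof -
  have "\<bar>coag_form f f x\<bar> \<le> 2 / \<alpha> * (2 / \<alpha>) + 2 / \<alpha> * (20 / \<alpha>) + 2 / \<alpha> * (20 / \<alpha>)"
  proof (rule coag_form_bound_near[OF adm_cont adm_cont])
    show "\<bar>f y\<bar> \<le> 2 / \<alpha>" if "0 \<le> y" "y \<le> x" for y
      using adm_near[of y] adm_nonneg[of y] that assms by simp
    then show "\<bar>f y\<bar> \<le> 2 / \<alpha>" if "0 \<le> y" "y \<le> x" for y using that by auto
  qed (use assms z adm_moments in auto)
  also have "\<dots> \<le> 100 / \<alpha>\<^sup>2" using \<alpha> by (simp add: power2_eq_square divide_simps)
  finally show ?thesis .
qed

lemma adm_J_far: assumes "0 \<le> x" shows "\<bar>coag_form f f x\<bar> \<le> 320 * E\<^sup>2 / \<alpha>\<^sup>2 * (exp (- b * x) / (1 + x))"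
proof -
  have "5 * (8 * E / \<alpha>) * (8 * E / \<alpha>) = 320 * E\<^sup>2 / \<alpha>\<^sup>2" by (simp add: power2_eq_square)
  then show ?thesis using coag_form_bound_weight[OF adm_dominated adm_dominated assms] b by auto
qed

lemma adm_PJ_integrable: "set_integrable lborel {0..} (\<lambda>x. P x * coag_form f f x)"
  by (rule P_integrable(1)[OF adm_J_cont adm_J_far])

lemma adm_PJ_superadditive:
  assumes "z\<^sub>1 \<le> z" "0 \<le> \<kappa>"
    and \<kappa>: "\<And>x y. z\<^sub>0 / 2 \<le> x \<Longrightarrow> x < z\<^sub>1 \<Longrightarrow> z\<^sub>0 / 2 \<le> y \<Longrightarrow> y < z\<^sub>1 \<Longrightarrow> \<kappa> \<le> indicator {z..} (x + y) * P (x + y)"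
  shows "\<kappa> * (z\<^sub>0 / 2) * (h / 2)\<^sup>2 * (z\<^sub>1 - z\<^sub>0 / 2)\<^sup>2 \<le> (LBINT x:{z..}. P x * coag_form f f x)"
proof -
  define \<phi> where "\<phi> x = indicator {z..} x * P x" for x
  have z0: "0 < z" using assms z by simp
  have meas: "\<phi> \<in> borel_measurable borel"
    using set_measurable_continuous_on[OF _ continuous_on_subset[OF P_cont], of "{z..}"] z0
    by (simp add: set_borel_measurable_def \<phi>_def[abs_def])
  have \<phi>: "\<phi> x \<ge> 0" for x using P_pos[of x] by (simp add: \<phi>_def)
  have int: "set_integrable lborel {0..} (\<lambda>x. \<phi> x * g x)" 
    if "continuous_on {0..} g" "\<And>x. x \<ge> 0 \<Longrightarrow> \<bar>g x\<bar> \<le> C * (exp (- b * x) / (1 + x))" for g C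
  proof -
    have "set_integrable lborel {z..} (\<lambda>x. P x * g x)"
      by (rule set_integrable_subset[OF P_integrable(1)[OF that]]) (use z0 in auto)
    moreover have "(\<lambda>x. indicator {0..} x *\<^sub>R (\<phi> x * g x)) = (\<lambda>x. indicator {z..} x *\<^sub>R (P x * g x))"
      using z0 by (auto simp: \<phi>_def indicator_def)
    ultimately show ?thesis by (simp add: set_integrable_def)
  qed
  have b1: "1 \<le> b" using b by simp
  have g: "set_integrable lborel {0..} (\<lambda>x. \<phi> x * (x / 2 * conv f f x))"
    by (rule int[where C = "4 * (8 * E / \<alpha> * (8 * E / \<alpha>))"])
       (use gain_bound_weight[OF adm_dominated adm_dominated] in
         \<open>auto simp: weight_mult mult.assoc intro!: continuous_intros continuous_on_conv adm_cont\<close>)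
  have l: "set_integrable lborel {0..} (\<lambda>x. \<phi> x * (f x * (x * mom0 f + mom1 f)))"
    by (rule int[where C = "8 * E / \<alpha> * (8 * E / \<alpha>)"])
       (use loss_bound_weight[OF adm_dominated adm_dominated _ b1] in
         \<open>auto simp: weight_mult mult.assoc intro!: continuous_intros continuous_on_conv adm_cont\<close>)
  have super: "\<phi> x + \<phi> y + \<kappa> * indicator {z\<^sub>0 / 2..<z\<^sub>1} x * indicator {z\<^sub>0 / 2..<z\<^sub>1} y \<le> \<phi> (x + y)"
    if "x \<ge> 0" "y \<ge> 0" for x y
  proof (cases "x \<in> {z\<^sub>0 / 2..<z\<^sub>1} \<and> y \<in> {z\<^sub>0 / 2..<z\<^sub>1}")
    case True
    then have "\<phi> x = 0" "\<phi> y = 0" using assms(1) by (auto simp: \<phi>_def)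
    then show ?thesis using \<kappa>[of x y] True by (simp add: \<phi>_def[of "x + y"])
  next
    case False
    have "\<phi> x + \<phi> y \<le> \<phi> (x + y)"
    proof (cases "x \<ge> z \<and> y \<ge> z")
      case T: True
      have "P x / x \<le> P (x + y) / (x + y)" "P y / y \<le> P (x + y) / (x + y)"
        using T assms that by (auto intro!: P_ratio_mono)
      then have "x * (P x / x) + y * (P y / y) \<le> x * (P (x + y) / (x + y)) + y * (P (x + y) / (x + y))"
        using that by (intro add_mono mult_left_mono) auto
      also have "\<dots> = P (x + y)"
        using T z0 unfolding distrib_right[symmetric] by simp
      finally show ?thesis using T z0 by (simp add: \<phi>_def)
    next
      case F: False
      consider "x < z" "y < z" | "x \<ge> z" "y < z" | "x < z" "y \<ge> z" using F by linarith
      then show ?thesis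
        by cases (use that P_mono[of x "x + y"] P_mono[of y "x + y"] \<phi>[of "x + y"] in \<open>auto simp: \<phi>_def\<close>)
    qed
    moreover have "\<kappa> * indicator {z\<^sub>0 / 2..<z\<^sub>1} x * indicator {z\<^sub>0 / 2..<z\<^sub>1} y = 0" using False by auto
    ultimately show ?thesis by linarith
  qed
  have "\<kappa> * (z\<^sub>0 / 2) * (h / 2)\<^sup>2 * (z\<^sub>1 - z\<^sub>0 / 2)\<^sup>2 \<le> (LBINT x:{0..}. \<phi> x * coag_form f f x)"
    by (rule weak_form_superadditive[OF adm_dominated b1 adm_nonneg meas \<phi> g l])
       (use assms z h adm_lower super in auto)
  also have "\<dots> = (LBINT x:{z..}. P x * coag_form f f x)"
    unfolding set_lebesgue_integral_def
    using z0 by (intro Bochner_Integration.integral_cong) (auto simp: \<phi>_def indicator_def)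
  finally show ?thesis .
qed

lemma adm_PJ_nonneg: assumes "z\<^sub>1 \<le> z" shows "0 \<le> (LBINT x:{z..}. P x * coag_form f f x)"
  using adm_PJ_superadditive[OF assms, of 0] by (auto simp: P_nonneg)

text \<open>
  The tail from \<open>z\<^sub>1\<close> on contributes at least \<open>2 c P(z\<^sub>0)\<close>: two sizes in \<open>[z\<^sub>0/2, z\<^sub>1)\<close> add up to a
  size of at least \<open>z\<^sub>0\<close>. The part before \<open>z\<^sub>1\<close> may be negative, but there \<open>P\<close> is at most
  \<open>1/(h \<alpha>)\<close>, which is negligible.
\<close>

lemma rate_ge: "c * P z\<^sub>0 \<le> rate f"
proof -
  have "2 * (c * P z\<^sub>0) = P z\<^sub>0 * (z\<^sub>0 / 2) * (h / 2)\<^sup>2 * (z\<^sub>1 - z\<^sub>0 / 2)\<^sup>2"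
    by (simp add: c power2_eq_square)
  also have "\<dots> \<le> (LBINT x:{z\<^sub>1..}. P x * coag_form f f x)"
    using z by (intro adm_PJ_superadditive) (auto simp: P_nonneg intro!: P_mono)
  finally have far: "2 * (c * P z\<^sub>0) \<le> (LBINT x:{z\<^sub>1..}. P x * coag_form f f x)" .
  have "h * (\<alpha> * P z\<^sub>1) \<le> h * (a z\<^sub>1 * P z\<^sub>1)"
    using h z P_pos[of z\<^sub>1] by (intro mult_left_mono mult_right_mono a_ge) auto
  also have "\<dots> \<le> 1"
    using near[of z\<^sub>1] z a_pos[of z\<^sub>1] P_pos[of z\<^sub>1] by (simp add: field_simps)
  finally have "P z\<^sub>1 \<le> 1 / (h * \<alpha>)" using h \<alpha> by (simp add: field_simps)
  then have "P z\<^sub>1 * (100 / \<alpha>\<^sup>2) \<le> 1 / (h * \<alpha>) * (100 / \<alpha>\<^sup>2)" by (intro mult_right_mono) auto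
  also have "\<dots> \<le> c * P z\<^sub>0"
    using C1 h \<alpha> by (simp add: power2_eq_square power3_eq_cube field_simps)
  finally have "P z\<^sub>1 * (100 / \<alpha>\<^sup>2) \<le> c * P z\<^sub>0" .
  moreover have "\<bar>LBINT x:{0..z\<^sub>1}. P x * coag_form f f x\<bar> \<le> P z\<^sub>1 * (100 / \<alpha>\<^sup>2)"
    using z by (intro P_integral_near adm_J_cont adm_J_near) auto
  moreover have "rate f = (LBINT x:{0..z\<^sub>1}. P x * coag_form f f x) + (LBINT x:{z\<^sub>1..}. P x * coag_form f f x)"
    unfolding rate_def using z by (intro set_integral_split adm_PJ_integrable) auto
  ultimately show ?thesis using far by linarith
qed

lemma rate_pos: "0 < rate f"
  using rate_ge c_bounds P_pos[of z\<^sub>0] by (meson less_le_trans mult_pos_pos)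

text \<open>
  Splitting off the integral over \<open>[0, x]\<close> exhibits the profile \<open>1/(a P)\<close> and a correction that
  involves only sizes at most \<open>x\<close>.
\<close>

lemma step_near: assumes "0 \<le> x"
  shows "step f x = (1 - (LBINT y:{0..x}. P y * coag_form f f y) / rate f) / (a x * P x)"
proof -
  have "(LBINT y:{x..}. P y * coag_form f f y) = rate f - (LBINT y:{0..x}. P y * coag_form f f y)"
    using set_integral_split[OF adm_PJ_integrable assms] by (simp add: rate_def)
  then show ?thesis unfolding step_def using rate_pos a_pos[OF assms] P_pos[of x] by (simp add: field_simps)
qed

lemma step_cont: "continuous_on {0..} (step f)"
proof -
  have c: "continuous_on {0..} (\<lambda>x. P x * coag_form f f x)"
    by (intro continuous_intros P_cont adm_J_cont)
  have "continuous_on {0..R} (\<lambda>x. LBINT y:{0..x}. P y * coag_form f f y)" if "R \<ge> 0" for R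
  proof -
    have "continuous_on {0..R} (\<lambda>x. integral {0..x} (\<lambda>y. P y * coag_form f f y))"
      by (intro indefinite_integral_continuous_1 integrable_continuous_real continuous_on_subset[OF c]) auto
    then show ?thesis
      by (rule continuous_on_eq)
         (auto intro!: set_borel_integral_eq_integral(2)[symmetric] borel_integrable_atLeastAtMost' continuous_on_subset[OF c])
  qed
  then have "continuous_on {0..} (\<lambda>x. LBINT y:{0..x}. P y * coag_form f f y)"
    by (intro continuous_on_atLeast_if_atLeastAtMost)
  then have "continuous_on {0..} (\<lambda>x. (1 - (LBINT y:{0..x}. P y * coag_form f f y) / rate f) / (a x * P x))"
    using rate_pos a_pos P_pos
    by (intro continuous_intros a_cont P_cont) (auto simp: less_imp_neq[symmetric])
  then show ?thesis by (rule continuous_on_eq) (simp add: step_near)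
qed

lemma step_near_bound: assumes "0 \<le> x" "x \<le> z\<^sub>0"
  shows "\<bar>(LBINT y:{0..x}. P y * coag_form f f y) / (rate f * (a x * P x))\<bar> \<le> 100 / \<alpha>\<^sup>2 / (c * P z\<^sub>0 * \<alpha>)"
  using assms c_bounds \<alpha> a_ge rate_ge P_pos
  by (intro quotient_bound P_integral_near adm_J_cont adm_J_near) auto

lemma step_far: assumes "z\<^sub>0 \<le> x" shows "\<bar>step f x\<bar> \<le> \<tau> * weight b x"
proof -
  have x: "0 \<le> x" using assms z by simp
  have w: "0 < weight b x" by (rule weight_pos[OF x])
  have "\<bar>step f x\<bar> \<le> 320 * E\<^sup>2 / \<alpha>\<^sup>2 * (exp (- b * x) / (1 + x)) / (c * P z\<^sub>0 * (c\<^sub>0 * (1 + x)))"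
    unfolding step_def using assms x c_bounds c\<^sub>0 a_far rate_ge P_pos adm_J_far
    by (intro quotient_bound P_integrable(2) adm_J_cont) auto
  also have "\<dots> = 320 * E\<^sup>2 / (\<alpha>\<^sup>2 * c * c\<^sub>0 * P z\<^sub>0) * weight b x"
    by (simp add: weight_def power2_eq_square)
  also have "\<dots> \<le> \<tau> * weight b x"
    using C2 w \<alpha> c_bounds c\<^sub>0 P_pos[of z\<^sub>0] by (intro mult_right_mono) (simp_all add: divide_le_eq mult.assoc)
  finally show ?thesis .
qed

text \<open>
  Up to \<open>z\<^sub>0\<close> the image is within \<open>h/2\<close> of the profile, which lies between \<open>h\<close> (up to \<open>z\<^sub>1\<close>) and
  \<open>1/\<alpha>\<close>. Beyond \<open>z\<^sub>1\<close> it is nonnegative by superadditivity.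
\<close>

lemma adm_step: "adm (step f)"
proof -
  have nr: "\<bar>step f x - 1 / (a x * P x)\<bar> \<le> h / 2" if x: "0 \<le> x" "x \<le> z\<^sub>0" for x
  proof -
    have "step f x - 1 / (a x * P x) = - ((LBINT y:{0..x}. P y * coag_form f f y) / (rate f * (a x * P x)))"
      unfolding step_near[OF x(1)] using rate_pos a_pos[OF x(1)] P_pos[of x] by (simp add: diff_divide_distrib)
    then have "\<bar>step f x - 1 / (a x * P x)\<bar> \<le> 100 / \<alpha>\<^sup>2 / (c * P z\<^sub>0 * \<alpha>)"
      using step_near_bound[OF x] by simp
    also have "\<dots> \<le> h / 2"
      using C1 \<alpha> c_bounds P_pos[of z\<^sub>0] by (simp add: power2_eq_square power3_eq_cube field_simps)
    finally show ?thesis .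
  qed
  have up: "step f x \<le> 2 / \<alpha>" if x: "0 \<le> x" "x \<le> z\<^sub>0" for x
  proof -
    have "1 * \<alpha> \<le> P x * a x" using P_ge_1[OF x(1)] a_ge[OF x(1)] \<alpha> P_pos[of x] by (intro mult_mono) auto
    then have "1 / (a x * P x) \<le> 1 / \<alpha>" using \<alpha> by (intro divide_left_mono) (auto simp: mult.commute intro!: mult_pos_pos a_pos P_pos x)
    moreover have "h / 2 \<le> 1 / \<alpha>" using h \<alpha> by (simp add: field_simps) (meson mult_left_le mult_mono' order_trans less_imp_le one_le_numeral)
    ultimately show ?thesis using nr[OF x] by linarith
  qed
  have low: "h / 2 \<le> step f x" if x: "0 \<le> x" "x \<le> z\<^sub>1" for x
    using nr[of x] near[OF x] x z by linarith
  have nn: "0 \<le> step f x" if x: "0 \<le> x" for x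
  proof (cases "x \<le> z\<^sub>1")
    case True then show ?thesis using low[OF x] h by simp
  next
    case False
    then show ?thesis unfolding step_def
      using adm_PJ_nonneg[of x] rate_pos a_pos[OF x] P_pos[of x] by simp
  qed
  show ?thesis unfolding adm_def using up low nn step_cont step_far by (auto simp: abs_le_iff)
qed

end

text \<open>
  The difference of two images has a part from the numerators and a part from the normalising
  factors. Up to powers of \<open>1/\<alpha>\<close>, both are \<open>O(1/P(z\<^sub>0))\<close> in the sup norm on \<open>[0, z\<^sub>0]\<close>, hence
  \<open>O(E/P(z\<^sub>0))\<close> in the weighted norm. In the tail the first is \<open>O(E/P(z\<^sub>0))\<close>, while the second is the relative
  change of \<open>rate\<close>, which is of order \<open>\<Delta>/\<alpha>\<close>, times the size \<open>\<tau>\<close> of the tail; this is why \<open>\<tau>\<close> has to be small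
  compared with \<open>\<alpha>\<close>.
\<close>

lemma step_contract:
  assumes f: "adm f" and g: "adm g" and d: "\<And>x. x \<ge> 0 \<Longrightarrow> \<bar>f x - g x\<bar> \<le> \<Delta> * weight b x" and x: "0 \<le> x"
  shows "\<bar>step f x - step g x\<bar> \<le> \<Delta> / 2 * weight b x"
proof -
  have b1: "1 \<le> b" using b by simp
  have dom: "dominated b \<Delta> (\<lambda>x. f x - g x)"
    unfolding dominated_def using d adm_cont[OF f] adm_cont[OF g] by (auto intro: continuous_intros)
  have \<Delta>: "0 \<le> \<Delta>" by (rule dominated_nonneg[OF dom])
  have "8 * E / \<alpha> + 8 * E / \<alpha> = 16 * E / \<alpha>" by simp
  then have sum: "dominated b (16 * E / \<alpha>) (\<lambda>x. f x + g x)"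
    using dominated_add[OF adm_dominated[OF f] adm_dominated[OF g]] by simp
  define j where "j x = coag_form f f x - coag_form g g x" for x
  have j: "j = coag_form (\<lambda>x. f x + g x) (\<lambda>x. f x - g x)"
    by (rule ext) (simp add: j_def coag_form_diff[OF adm_dominated[OF f] adm_dominated[OF g] b1])
  have jc: "continuous_on {0..} j"
    unfolding j_def[abs_def] by (intro continuous_intros adm_J_cont f g)
  have jfar: "\<bar>j y\<bar> \<le> 80 * E * \<Delta> / \<alpha> * (exp (- b * y) / (1 + y))" if "y \<ge> 0" for y
  proof -
    have "5 * (16 * E / \<alpha>) * \<Delta> = 80 * E * \<Delta> / \<alpha>" by simp
    then show ?thesis using coag_form_bound_weight[OF sum dom that b1] unfolding j by simp
  qed
  have jnear: "\<bar>j y\<bar> \<le> 50 * \<Delta> / \<alpha>" if y: "0 \<le> y" "y \<le> z\<^sub>0" for y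
  proof -
    note mf = dominated_moments[OF adm_dominated[OF f] b1] and mg = dominated_moments[OF adm_dominated[OF g] b1]
    have m: "mom0 (\<lambda>x. f x + g x) = mom0 f + mom0 g" "mom1 (\<lambda>x. f x + g x) = mom1 f + mom1 g"
      using mf mg by (simp_all add: mom0_def mom1_def distrib_left)
    have "\<bar>j y\<bar> \<le> 4 / \<alpha> * \<Delta> + 4 / \<alpha> * \<Delta> + \<Delta> * (40 / \<alpha>)"
      unfolding j
    proof (rule coag_form_bound_near)
      fix t assume t: "0 \<le> t" "t \<le> y"
      then show "\<bar>f t + g t\<bar> \<le> 4 / \<alpha>"
        using adm_near[OF f, of t] adm_near[OF g, of t] adm_nonneg[OF f, of t] adm_nonneg[OF g, of t] y by simp
      have "\<Delta> * weight b t \<le> \<Delta> * 1" using \<Delta> t by (intro mult_left_mono weight_le_1) auto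
      then show "\<bar>f t - g t\<bar> \<le> \<Delta>" using d[of t] t by simp
    next
      show "\<bar>mom0 (\<lambda>x. f x + g x)\<bar> \<le> 40 / \<alpha>" "\<bar>mom1 (\<lambda>x. f x + g x)\<bar> \<le> 40 / \<alpha>"
        unfolding m using adm_moments[OF f] adm_moments[OF g] by (simp_all add: abs_le_iff)
    next
      show "continuous_on {0..} (\<lambda>x. f x + g x)" "continuous_on {0..} (\<lambda>x. f x - g x)"
        using dominatedD(1)[OF sum] dominatedD(1)[OF dom] by auto
    qed (use y z dominated_moments[OF dom b1] in auto)
    also have "\<dots> \<le> 50 * \<Delta> / \<alpha>" using \<Delta> \<alpha> by (simp add: field_simps)
    finally show ?thesis .
  qed
  note If = adm_PJ_integrable[OF f] and Ig = adm_PJ_integrable[OF g]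
  note qf = rate_pos[OF f] and qg = rate_pos[OF g]
  have Pj: "P x * j x = P x * coag_form f f x - P x * coag_form g g x" for x
    by (simp add: j_def right_diff_distrib)
  have diff: "(LBINT x:S. P x * j x) = (LBINT x:S. P x * coag_form f f x) - (LBINT x:S. P x * coag_form g g x)"
    if "S \<in> sets lborel" "S \<subseteq> {0..}" for S
    unfolding Pj using that by (intro set_integral_diff(2) set_integrable_subset[OF If] set_integrable_subset[OF Ig])
  have dq: "\<bar>rate f - rate g\<bar> \<le> 130 * P z\<^sub>0 * \<Delta> / \<alpha>"
  proof -
    have "rate f - rate g = (LBINT x:{0..}. P x * j x)"
      by (simp add: diff rate_def)
    also have "\<dots> = (LBINT x:{0..z\<^sub>0}. P x * j x) + (LBINT x:{z\<^sub>0..}. P x * j x)"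
      using z by (intro set_integral_split P_integrable(1)[OF jc jfar]) auto
    finally have "\<bar>rate f - rate g\<bar> \<le> \<bar>LBINT x:{0..z\<^sub>0}. P x * j x\<bar> + \<bar>LBINT x:{z\<^sub>0..}. P x * j x\<bar>"
      by simp
    moreover have "\<bar>LBINT x:{0..z\<^sub>0}. P x * j x\<bar> \<le> P z\<^sub>0 * (50 * \<Delta> / \<alpha>)"
      using z by (intro P_integral_near jc jnear) auto
    moreover have "\<bar>LBINT x:{z\<^sub>0..}. P x * j x\<bar> \<le> P z\<^sub>0 * (80 * E * \<Delta> / \<alpha> * (exp (- b * z\<^sub>0) / (1 + z\<^sub>0)))"
      by (rule P_integrable(2)[OF jc jfar]) auto
    moreover have "P z\<^sub>0 * (80 * E * \<Delta> / \<alpha> * (exp (- b * z\<^sub>0) / (1 + z\<^sub>0))) \<le> P z\<^sub>0 * (80 * \<Delta> / \<alpha>)"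
    proof (rule mult_left_mono[OF _ P_nonneg])
      have "E * exp (- b * z\<^sub>0) = 1" by (simp add: E mult_exp_exp)
      then have "80 * E * \<Delta> / \<alpha> * (exp (- b * z\<^sub>0) / (1 + z\<^sub>0)) = 80 * \<Delta> / \<alpha> * (1 / (1 + z\<^sub>0))"
        by (simp add: mult.assoc mult.left_commute[of E])
      also have "\<dots> \<le> 80 * \<Delta> / \<alpha> * 1" using z \<Delta> \<alpha> by (intro mult_left_mono) auto
      finally show "80 * E * \<Delta> / \<alpha> * (exp (- b * z\<^sub>0) / (1 + z\<^sub>0)) \<le> 80 * \<Delta> / \<alpha>" by simp
    qed
    ultimately have "\<bar>rate f - rate g\<bar> \<le> P z\<^sub>0 * (50 * \<Delta> / \<alpha>) + P z\<^sub>0 * (80 * \<Delta> / \<alpha>)" by linarith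
    also have "\<dots> = 130 * P z\<^sub>0 * \<Delta> / \<alpha>" by (simp add: field_simps)
    finally show ?thesis .
  qed
  have rel: "\<bar>(rate f - rate g) / rate f\<bar> \<le> 130 * \<Delta> / (\<alpha> * c)"
  proof -
    have "\<bar>(rate f - rate g) / rate f\<bar> = \<bar>rate f - rate g\<bar> / rate f" using qf by simp
    also have "\<dots> \<le> (130 * P z\<^sub>0 * \<Delta> / \<alpha>) / (c * P z\<^sub>0)"
      using dq rate_ge[OF f] c_bounds P_pos[of z\<^sub>0] by (intro frac_le) auto
    also have "\<dots> = 130 * \<Delta> / (\<alpha> * c)" using P_pos[of z\<^sub>0] by (simp add: mult.commute)
    finally show ?thesis .
  qed
  have w: "0 < weight b x" by (rule weight_pos[OF x])
  have aP: "0 < a x * P x" using a_pos[OF x] P_pos[of x] by simp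
  show ?thesis
  proof (cases "x \<le> z\<^sub>0")
    case True
    let ?f = "LBINT y:{0..x}. P y * coag_form f f y" and ?g = "LBINT y:{0..x}. P y * coag_form g g y"
    have eq: "step f x - step g x = - ((?f - ?g) / (rate f * (a x * P x))) + (?g / (rate g * (a x * P x))) * ((rate f - rate g) / rate f)"
    proof -
      have "(1 - F / p) / k - (1 - G / q) / k = - ((F - G) / (p * k)) + G / (q * k) * ((p - q) / p)"
        if "p > 0" "q > 0" "k > 0" for F G p q k :: real
      proof -
        have "G / (q * k) * ((p - q) / p) = G / (q * k) - G / (p * k)"
          using that by (simp add: diff_divide_distrib right_diff_distrib)
        then show ?thesis by (simp add: diff_divide_distrib)
      qed
      from this[OF qf qg aP] show ?thesis unfolding step_near[OF f x] step_near[OF g x] .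
    qed
    have "\<bar>step f x - step g x\<bar> \<le> \<bar>(?f - ?g) / (rate f * (a x * P x))\<bar> + \<bar>?g / (rate g * (a x * P x))\<bar> * \<bar>(rate f - rate g) / rate f\<bar>"
      unfolding eq by (rule order_trans[OF abs_triangle_ineq]) (simp add: abs_mult)
    also have "\<dots> \<le> 50 * \<Delta> / \<alpha> / (c * P z\<^sub>0 * \<alpha>) + 100 / \<alpha>\<^sup>2 / (c * P z\<^sub>0 * \<alpha>) * (130 * \<Delta> / (\<alpha> * c))"
    proof (intro add_mono mult_mono rel step_near_bound[OF g] x True)
      have "\<bar>?f - ?g\<bar> \<le> P x * (50 * \<Delta> / \<alpha>)"
        using P_integral_near[OF jc jnear x True] by (simp add: diff)
      then show "\<bar>(?f - ?g) / (rate f * (a x * P x))\<bar> \<le> 50 * \<Delta> / \<alpha> / (c * P z\<^sub>0 * \<alpha>)"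
        using x c_bounds \<alpha> a_ge rate_ge[OF f] P_pos by (intro quotient_bound) auto
    qed (use c_bounds \<alpha> P_pos[of z\<^sub>0] in auto)
    also have "\<dots> \<le> 13050 * \<Delta> / (c\<^sup>2 * \<alpha>^4 * P z\<^sub>0)"
    proof -
      have "50 * \<Delta> / \<alpha> / (c * P z\<^sub>0 * \<alpha>) = (50 * \<Delta> / P z\<^sub>0) * (1 / (c * \<alpha>\<^sup>2))"
        by (simp add: power2_eq_square)
      also have "\<dots> \<le> (50 * \<Delta> / P z\<^sub>0) * (1 / (c\<^sup>2 * \<alpha>^4))"
      proof (intro mult_left_mono divide_left_mono)
        have "c\<^sup>2 \<le> c" "\<alpha>^4 \<le> \<alpha>\<^sup>2"
          using c_bounds \<alpha> power_decreasing[of 1 2 c] power_decreasing[of 2 4 \<alpha>] by auto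
        then show "c\<^sup>2 * \<alpha>^4 \<le> c * \<alpha>\<^sup>2" using c_bounds \<alpha> by (intro mult_mono) auto
      qed (use c_bounds \<alpha> \<Delta> P_pos[of z\<^sub>0] in auto)
      finally have 1: "50 * \<Delta> / \<alpha> / (c * P z\<^sub>0 * \<alpha>) \<le> 50 * \<Delta> / (c\<^sup>2 * \<alpha>^4 * P z\<^sub>0)"
        by (simp add: mult_ac)
      have 2: "100 / \<alpha>\<^sup>2 / (c * P z\<^sub>0 * \<alpha>) * (130 * \<Delta> / (\<alpha> * c)) = 13000 * \<Delta> / (c\<^sup>2 * \<alpha>^4 * P z\<^sub>0)"
        by (simp add: power2_eq_square power4_eq_xxxx mult_ac)
      have "50 * \<Delta> / (c\<^sup>2 * \<alpha>^4 * P z\<^sub>0) + 13000 * \<Delta> / (c\<^sup>2 * \<alpha>^4 * P z\<^sub>0) = 13050 * \<Delta> / (c\<^sup>2 * \<alpha>^4 * P z\<^sub>0)"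
        by (simp add: add_divide_distrib[symmetric])
      with add_right_mono[OF 1, of "13000 * \<Delta> / (c\<^sup>2 * \<alpha>^4 * P z\<^sub>0)"]
      show ?thesis unfolding 2 by simp
    qed
    also have "\<dots> \<le> \<Delta> / (8 * E)"
    proof -
      have "13050 * (8 * E) \<le> c\<^sup>2 * \<alpha>^4 * P z\<^sub>0" using C3 E_ge_1 by linarith
      then have "\<Delta> * (13050 * (8 * E)) \<le> \<Delta> * (c\<^sup>2 * \<alpha>^4 * P z\<^sub>0)" using \<Delta> by (rule mult_left_mono)
      moreover have "0 < c\<^sup>2 * \<alpha>^4 * P z\<^sub>0" using c_bounds \<alpha> P_pos[of z\<^sub>0] by simp
      ultimately show ?thesis using E_ge_1 by (simp add: divide_le_eq le_divide_eq mult_ac)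
    qed
    also have "\<dots> \<le> \<Delta> / 2 * weight b x"
    proof -
      have "\<Delta> / (8 * E) * 1 \<le> \<Delta> / (8 * E) * (4 * E * weight b x)"
        using \<Delta> E_ge_1 by (intro mult_left_mono weight_near x True) auto
      also have "\<dots> = \<Delta> / 2 * weight b x" using E_ge_1 by simp
      finally show ?thesis by simp
    qed
    finally show ?thesis .
  next
    case False
    then have x0: "z\<^sub>0 \<le> x" by simp
    let ?f = "LBINT y:{x..}. P y * coag_form f f y" and ?g = "LBINT y:{x..}. P y * coag_form g g y"
    have eq: "step f x - step g x = (?f - ?g) / (rate f * (a x * P x)) - step g x * ((rate f - rate g) / rate f)"
    proof -
      have "F / (p * k) - G / (q * k) = (F - G) / (p * k) - G / (q * k) * ((p - q) / p)"
        if "p > 0" "q > 0" "k > 0" for F G p q k :: real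
      proof -
        have "G / (q * k) * ((p - q) / p) = G / (q * k) - G / (p * k)"
          using that by (simp add: diff_divide_distrib right_diff_distrib)
        then show ?thesis by (simp add: diff_divide_distrib)
      qed
      from this[OF qf qg aP] show ?thesis unfolding step_def .
    qed
    have "\<bar>step f x - step g x\<bar> \<le> \<bar>(?f - ?g) / (rate f * (a x * P x))\<bar> + \<bar>step g x\<bar> * \<bar>(rate f - rate g) / rate f\<bar>"
      unfolding eq by (rule order_trans[OF abs_triangle_ineq4]) (simp add: abs_mult)
    also have "\<dots> \<le> 80 * E * \<Delta> / \<alpha> * (exp (- b * x) / (1 + x)) / (c * P z\<^sub>0 * (c\<^sub>0 * (1 + x))) + \<tau> * weight b x * (130 * \<Delta> / (\<alpha> * c))"
    proof (intro add_mono mult_mono rel step_far[OF g] x0)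
      have "\<bar>?f - ?g\<bar> \<le> P x * (80 * E * \<Delta> / \<alpha> * (exp (- b * x) / (1 + x)))"
        using P_integrable(2)[OF jc jfar x0] x by (simp add: diff)
      then show "\<bar>(?f - ?g) / (rate f * (a x * P x))\<bar> \<le> 80 * E * \<Delta> / \<alpha> * (exp (- b * x) / (1 + x)) / (c * P z\<^sub>0 * (c\<^sub>0 * (1 + x)))"
        using x x0 c_bounds c\<^sub>0 a_far rate_ge[OF f] P_pos by (intro quotient_bound) auto
    qed (use \<tau> w in auto)
    also have "\<dots> = \<Delta> * weight b x * (80 * E / (\<alpha> * c * c\<^sub>0 * P z\<^sub>0) + 130 * \<tau> / (\<alpha> * c))"
      by (simp add: weight_def power2_eq_square distrib_left mult_ac)
    also have "\<dots> \<le> \<Delta> * weight b x * (1 / 4 + 1 / 4)"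
      using \<Delta> w C4 \<tau> c_bounds c\<^sub>0 \<alpha> P_pos[of z\<^sub>0]
      by (intro mult_left_mono add_mono) (auto simp: divide_le_eq)
    finally show ?thesis by simp
  qed
qed

end

section \<open>Fixed points and steady states\<close>

context barrier
begin

lemma adm_cong: "adm f \<Longrightarrow> (\<And>x. x \<ge> 0 \<Longrightarrow> f x = g x) \<Longrightarrow> adm g"
  unfolding adm_def using z by (auto intro: continuous_on_eq)

text \<open>
  The weighted sup norm is carried over from bounded continuous functions on the line. Negative
  arguments are irrelevant, and \<open>lift\<close> fills them with the value at \<open>0\<close>.
\<close>

definition prof :: "(real \<Rightarrow>\<^sub>C real) \<Rightarrow> real \<Rightarrow> real" where
  "prof g x = weight b x * g x"

definition lift :: "(real \<Rightarrow> real) \<Rightarrow> real \<Rightarrow>\<^sub>C real" where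
  "lift f = Bcontfun (\<lambda>x. f (max 0 x) / weight b (max 0 x))"

definition adm_set :: "(real \<Rightarrow>\<^sub>C real) set" where
  "adm_set = {g. adm (prof g)}"

lemma lift_apply: assumes "adm f" shows "lift f x = f (max 0 x) / weight b (max 0 x)"
proof -
  have w: "0 < weight b (max 0 x)" for x by (rule weight_pos) simp
  have "continuous_on UNIV (\<lambda>x. f (max 0 x) / weight b (max 0 x))"
    using w by (intro continuous_intros continuous_on_compose2[OF adm_cont[OF assms]] continuous_on_compose2[OF continuous_on_weight])
      (auto simp: less_imp_neq[symmetric])
  moreover have "bounded (range (\<lambda>x. f (max 0 x) / weight b (max 0 x)))"
  proof (rule boundedI)
    fix y assume "y \<in> range (\<lambda>x. f (max 0 x) / weight b (max 0 x))"
    then obtain x where y: "y = f (max 0 x) / weight b (max 0 x)" by auto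
    have "\<bar>f (max 0 x)\<bar> \<le> 8 * E / \<alpha> * weight b (max 0 x)"
      by (rule dominatedD(2)[OF adm_dominated[OF assms]]) simp
    then show "norm y \<le> 8 * E / \<alpha>" using w[of x] by (simp add: y divide_le_eq)
  qed
  ultimately show ?thesis unfolding lift_def by (subst Bcontfun_inverse) (auto simp: bcontfun_def)
qed

lemma prof_lift: "adm f \<Longrightarrow> x \<ge> 0 \<Longrightarrow> prof (lift f) x = f x"
  using weight_pos[of x b] by (simp add: prof_def lift_apply max_def)

lemma lift_in_adm_set: "adm f \<Longrightarrow> lift f \<in> adm_set"
  unfolding adm_set_def by (auto intro: adm_cong simp: prof_lift)

lemma adm_set_nonempty: "adm_set \<noteq> {}"
proof -
  \<comment> \<open>\<open>h/2\<close> up to \<open>z\<^sub>1\<close>, then linear down to zero at \<open>z\<^sub>0\<close>\<close>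
  define k where "k x = h / 2 * max 0 (min 1 ((z\<^sub>0 - x) / (z\<^sub>0 - z\<^sub>1)))" for x
  have "adm k"
    unfolding adm_def
  proof (intro conjI allI impI)
    show "continuous_on {0..} k" unfolding k_def using z by (intro continuous_intros) auto
    show "0 \<le> k x" for x using h by (simp add: k_def)
    show "k x \<le> 2 / \<alpha>" for x
    proof -
      have "k x \<le> h / 2 * 1" unfolding k_def using h by (intro mult_left_mono) auto
      also have "\<dots> \<le> 2 / 1" using h by simp
      also have "\<dots> \<le> 2 / \<alpha>" using \<alpha> by (intro divide_left_mono) auto
      finally show ?thesis .
    qed
    show "h / 2 \<le> k x" if "0 \<le> x \<and> x \<le> z\<^sub>1" for x
    proof -
      have "1 \<le> (z\<^sub>0 - x) / (z\<^sub>0 - z\<^sub>1)" using that z by (simp add: le_divide_eq)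
      then show ?thesis by (simp add: k_def)
    qed
    show "k x \<le> \<tau> * weight b x" if "z\<^sub>0 \<le> x" for x
    proof -
      have "(z\<^sub>0 - x) / (z\<^sub>0 - z\<^sub>1) \<le> 0" using that z by (simp add: divide_le_0_iff)
      then have "k x = 0" by (simp add: k_def max_def min_def)
      then show ?thesis using that z \<tau> weight_pos[of x b] by simp
    qed
  qed
  then show ?thesis using lift_in_adm_set by auto
qed

lemma adm_set_complete: "complete adm_set"
  unfolding complete_eq_closed closed_sequential_limits
proof (intro allI impI)
  fix s l assume s: "(\<forall>n. s n \<in> adm_set) \<and> s \<longlonglongrightarrow> l"
  have lim: "(\<lambda>n. prof (s n) x) \<longlonglongrightarrow> prof l x" for x
    unfolding prof_def
    by (intro tendsto_intros tendsto_uniform_limitI[OF tendsto_bcontfun_uniform_limit]) (use s in auto)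
  have adm: "adm (prof (s n))" for n using s by (auto simp: adm_set_def)
  have "adm (prof l)"
    unfolding adm_def
  proof (intro conjI allI impI)
    show "continuous_on {0..} (prof l)"
      unfolding prof_def by (intro continuous_intros continuous_on_weight continuous_on_apply_bcontfun)
    show "0 \<le> prof l x" if "0 \<le> x" for x
      by (rule LIMSEQ_le_const[OF lim]) (use adm_nonneg[OF adm that] in auto)
    show "prof l x \<le> 2 / \<alpha>" if "0 \<le> x \<and> x \<le> z\<^sub>0" for x
      by (rule LIMSEQ_le_const2[OF lim]) (use adm_near[OF adm] that in auto)
    show "h / 2 \<le> prof l x" if "0 \<le> x \<and> x \<le> z\<^sub>1" for x
      by (rule LIMSEQ_le_const[OF lim]) (use adm_lower[OF adm] that in auto)
    show "prof l x \<le> \<tau> * weight b x" if "z\<^sub>0 \<le> x" for x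
      by (rule LIMSEQ_le_const2[OF lim]) (use adm_far[OF adm] that in auto)
  qed
  then show "l \<in> adm_set" by (simp add: adm_set_def)
qed

lemma fixed_point_exists: "\<exists>f. adm f \<and> (\<forall>x\<ge>0. step f x = f x)"
proof -
  define T where "T g = lift (step (prof g))" for g
  have T: "T g \<in> adm_set" if "g \<in> adm_set" for g
    using that unfolding T_def adm_set_def by (intro lift_in_adm_set[unfolded adm_set_def] adm_step) auto
  have contr: "dist (T g) (T g') \<le> 1 / 2 * dist g g'" if g: "g \<in> adm_set" "g' \<in> adm_set" for g g'
  proof (rule dist_bound)
    fix x :: real
    define y where "y = max 0 x"
    have y: "y \<ge> 0" by (simp add: y_def)
    have w: "0 < weight b y" by (rule weight_pos[OF y])
    have a: "adm (prof g)" "adm (prof g')" using g by (auto simp: adm_set_def)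
    have "\<bar>prof g x - prof g' x\<bar> \<le> dist g g' * weight b x" if "x \<ge> 0" for x
    proof -
      have "prof g x - prof g' x = weight b x * (g x - g' x)"
        by (simp add: prof_def right_diff_distrib)
      then have "\<bar>prof g x - prof g' x\<bar> = weight b x * dist (g x) (g' x)"
        using weight_pos[OF that, of b] by (simp add: abs_mult dist_real_def)
      also have "\<dots> \<le> weight b x * dist g g'"
        using weight_pos[OF that, of b] by (intro mult_left_mono dist_bounded) auto
      finally show ?thesis by (simp add: mult.commute)
    qed
    from step_contract[OF a this y]
    have "\<bar>step (prof g) y - step (prof g') y\<bar> / weight b y \<le> 1 / 2 * dist g g'"
      using w by (simp add: divide_le_eq)
    moreover have "dist (T g x) (T g' x) = \<bar>step (prof g) y - step (prof g') y\<bar> / weight b y"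
      using w by (simp add: T_def lift_apply[OF adm_step] a dist_real_def y_def[symmetric] diff_divide_distrib[symmetric])
    ultimately show "dist (T g x) (T g' x) \<le> 1 / 2 * dist g g'" by simp
  qed
  have "\<exists>!g. g \<in> adm_set \<and> T g = g"
    using Banach_fix[OF adm_set_complete adm_set_nonempty, of "1 / 2" T] T contr by auto
  then obtain g where g: "g \<in> adm_set" "T g = g" by blast
  then have a: "adm (prof g)" by (simp add: adm_set_def)
  have "step (prof g) x = prof g x" if "x \<ge> 0" for x
    using prof_lift[OF adm_step[OF a] that] g(2) by (simp add: T_def)
  then show ?thesis using a by blast
qed

lemma adm_moments_pos:
  assumes f: "adm f"
  shows "0 < mom0 f" "0 < mom1 f"
proof -
  have b1: "1 \<le> b" using b by simp
  have pos: "0 < (LBINT x:{0..}. g x * f x)"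
    if "set_integrable lborel {0..} (\<lambda>x. g x * f x)" "continuous_on {0..} g"
      "\<And>x. x \<ge> 0 \<Longrightarrow> 0 \<le> g x" "\<And>x. z\<^sub>1 / 2 \<le> x \<Longrightarrow> x \<le> z\<^sub>1 \<Longrightarrow> z\<^sub>1 / 2 \<le> g x" for g
  proof -
    have i: "set_integrable lborel {z\<^sub>1 / 2..z\<^sub>1} (\<lambda>x. g x * f x)"
      by (rule set_integrable_subset[OF that(1)]) (use z in auto)
    have k: "set_integrable lborel {z\<^sub>1 / 2..z\<^sub>1} (\<lambda>x. z\<^sub>1 / 2 * (h / 2))"
      by (rule borel_integrable_atLeastAtMost') auto
    have "0 < z\<^sub>1 / 2 * (h / 2) * (z\<^sub>1 / 2)" using z h by simp
    also have "\<dots> = (LBINT x:{z\<^sub>1 / 2..z\<^sub>1}. z\<^sub>1 / 2 * (h / 2))"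
      using z by (simp add: set_lebesgue_integral_def)
    also have "\<dots> \<le> (LBINT x:{z\<^sub>1 / 2..z\<^sub>1}. g x * f x)"
    proof (rule set_integral_mono[OF k i])
      fix x assume "x \<in> {z\<^sub>1 / 2..z\<^sub>1}"
      then show "z\<^sub>1 / 2 * (h / 2) \<le> g x * f x"
        using that(4)[of x] adm_lower[OF f, of x] z h by (intro mult_mono) auto
    qed
    also have "\<dots> \<le> (LBINT x:{0..}. g x * f x)"
      unfolding set_lebesgue_integral_def
      by (rule integral_mono) (use i that z adm_nonneg[OF f] in \<open>auto simp: set_integrable_def indicator_def\<close>)
    finally show ?thesis .
  qed
  note m = dominated_moments[OF adm_dominated[OF f] b1]
  have "z\<^sub>1 / 2 \<le> 1" using z by simp
  then show "0 < mom0 f" "0 < mom1 f"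
    using pos[of "\<lambda>x. 1"] pos[of "\<lambda>x. x"] m(1,2) by (auto simp: mom0_def mom1_def)
qed

context
  fixes f assumes f: "adm f" and fixed: "\<And>x. x \<ge> 0 \<Longrightarrow> step f x = f x"
begin

lemma fixed_deriv: 
  assumes "x > 0"
  shows "((\<lambda>x. a x * f x) has_real_derivative - f x - 1 / rate f * coag_form f f x) (at x)"
proof -
  define N where "N x = integral {0..x} (\<lambda>y. P y * coag_form f f y)" for x
  have c: "continuous_on {0..} (\<lambda>x. P x * coag_form f f x)"
    by (intro continuous_intros P_cont adm_J_cont f)
  have q: "rate f > 0" by (rule rate_pos[OF f])
  have eq: "a y * f y = (1 - N y / rate f) / P y" if "y \<ge> 0" for y
  proof -
    have "N y = (LBINT t:{0..y}. P t * coag_form f f t)"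
      unfolding N_def by (intro set_borel_integral_eq_integral(2)[symmetric] borel_integrable_atLeastAtMost' continuous_on_subset[OF c]) auto
    moreover have "f y = (1 - (LBINT t:{0..y}. P t * coag_form f f t) / rate f) / (a y * P y)"
      using fixed[OF that] step_near[OF f that] by simp
    ultimately show ?thesis using a_pos[OF that] by simp
  qed
  have at: "at x within {0..} = at x" using assms by (intro at_within_interior) auto
  have dP: "(P has_real_derivative P x / a x) (at x)" using P_deriv[of x] assms by (simp add: at)
  have "(N has_real_derivative P x * coag_form f f x) (at x within {0..x + 1})"
    unfolding N_def using assms by (intro integral_has_real_derivative continuous_on_subset[OF c]) auto
  moreover have "at x within {0..x + 1} = at x" using assms by (intro at_within_interior) auto
  ultimately have dN: "(N has_real_derivative P x * coag_form f f x) (at x)" by simp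
  have "((\<lambda>y. (1 - N y / rate f) / P y) has_real_derivative
      ((- (P x * coag_form f f x / rate f)) * P x - (1 - N x / rate f) * (P x / a x)) / (P x * P x)) (at x)"
    using P_pos[of x] q by (auto intro!: derivative_eq_intros dN dP)
  also have "((- (P x * coag_form f f x / rate f)) * P x - (1 - N x / rate f) * (P x / a x)) / (P x * P x)
     = - ((1 - N x / rate f) / P x) / a x - 1 / rate f * coag_form f f x"
    using P_pos[of x] by (simp add: diff_divide_distrib mult_ac)
  also have "\<dots> = - f x - 1 / rate f * coag_form f f x"
    using eq[of x, symmetric] a_pos[of x] assms by simp
  finally have "((\<lambda>y. (1 - N y / rate f) / P y) has_real_derivative - f x - 1 / rate f * coag_form f f x) (at x)" .
  then show ?thesis
    by (rule has_field_derivative_transform_within_open[of _ _ _ "{0<..}"]) (use assms eq in auto)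
qed

text \<open>
  The derivative of \<open>x a(x) f(x)\<close> is \<open>a f - x f - \<epsilon> x J[f]\<close>. Integrated over \<open>[0, R]\<close> the boundary
  term vanishes as \<open>R \<rightarrow> \<infinity>\<close>, and the coagulation term does so by conservation of volume.
\<close>

lemma fixed_moment_identity:
  "set_integrable lborel {0..} (\<lambda>x. a x * f x)" "(LBINT x:{0..}. a x * f x) = mom1 f"
proof -
  have b1: "1 \<le> b" using b by simp
  note dom = adm_dominated[OF f]
  define D where "D = 8 * E / \<alpha>"
  note cf = adm_cont[OF f]
  have le: "\<bar>a x * f x\<bar> \<le> D * exp (- b * x)" if "x \<ge> z\<^sub>1" for x
  proof -
    have "\<bar>a x * f x\<bar> \<le> \<bar>x * f x\<bar>"
      unfolding abs_mult using that z a_le[of x] a_pos[of x] by (intro mult_right_mono) auto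
    also have "\<dots> \<le> D * exp (- b * x)"
      using dominated_le_exp(2)[OF dom] that z by (simp add: D_def)
    finally show ?thesis .
  qed
  have caf: "continuous_on {0..} (\<lambda>x. a x * f x)" by (intro continuous_intros a_cont cf)
  have "set_integrable lborel {z\<^sub>1..} (\<lambda>x. a x * f x)"
    using z by (intro exp_dominated_integral(1)[of _ _ D b] continuous_on_subset[OF caf] le) (use b1 in auto)
  then have "set_integrable lborel ({0..z\<^sub>1} \<union> {z\<^sub>1..}) (\<lambda>x. a x * f x)"
    by (intro set_integrable_Un borel_integrable_atLeastAtMost' continuous_on_subset[OF caf]) auto
  moreover have "{0..z\<^sub>1} \<union> {z\<^sub>1..} = {0..}" using z by auto
  ultimately show iaf: "set_integrable lborel {0..} (\<lambda>x. a x * f x)" by simp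
  have ixf: "set_integrable lborel {0..} (\<lambda>x. x * f x)" by (rule dominated_moments[OF dom b1])
  have cJ: "continuous_on {0..} (\<lambda>x. x * coag_form f f x)"
    by (intro continuous_intros adm_J_cont f)
  have int: "set_integrable lborel {0..} (\<lambda>x. x * g x)"
    if "continuous_on {0..} g" "\<And>x. x \<ge> 0 \<Longrightarrow> \<bar>g x\<bar> \<le> C * (exp (- b * x) / (1 + x))" for g C
  proof (rule exp_dominated_integral(1)[where b = b and C = C])
    have C: "0 \<le> C" using that(2)[of 0] by simp
    show "continuous_on {0..} (\<lambda>x. x * g x)" by (intro continuous_intros that)
    fix x :: real assume x: "0 \<le> x"
    have "\<bar>x * g x\<bar> \<le> x * (C * (exp (- b * x) / (1 + x)))"
      unfolding abs_mult using x that(2)[OF x] by (intro mult_mono) auto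
    also have "\<dots> = C * exp (- b * x) * (x / (1 + x))" by simp
    also have "\<dots> \<le> C * exp (- b * x) * 1" using C x by (intro mult_left_mono) auto
    finally show "\<bar>x * g x\<bar> \<le> C * exp (- b * x)" by simp
  qed (use b1 in auto)
  have ixJ: "set_integrable lborel {0..} (\<lambda>x. x * coag_form f f x)"
    by (rule int[OF adm_J_cont[OF f] adm_J_far[OF f]])
  have ig: "set_integrable lborel {0..} (\<lambda>x. x * (x / 2 * conv f f x))"
    by (rule int[where C = "4 * (8 * E / \<alpha> * (8 * E / \<alpha>))"])
       (use gain_bound_weight[OF dom dom] in
         \<open>auto simp: weight_mult mult.assoc intro!: continuous_intros continuous_on_conv cf\<close>)
  have il: "set_integrable lborel {0..} (\<lambda>x. x * (f x * (x * mom0 f + mom1 f)))"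
    by (rule int[where C = "8 * E / \<alpha> * (8 * E / \<alpha>)"])
       (use loss_bound_weight[OF dom dom _ b1] in
         \<open>auto simp: weight_mult mult.assoc intro!: continuous_intros continuous_on_conv cf\<close>)
  have mx: "set_integrable lborel {0..} (\<lambda>x. max 0 x * g x)" if "set_integrable lborel {0..} (\<lambda>x. x * g x)" for g :: "real \<Rightarrow> real"
    using that by (rule set_integrable_cong[THEN iffD1, rotated 3]) auto
  have "(LBINT x:{0..}. max 0 x * coag_form f f x) = 0"
    by (rule weak_form_additive[OF dom b1 adm_nonneg[OF f] _ _ mx[OF ig] mx[OF il]]) auto
  also have "(LBINT x:{0..}. max 0 x * coag_form f f x) = (LBINT x:{0..}. x * coag_form f f x)"
    by (rule set_lebesgue_integral_cong) auto
  finally have zero: "(LBINT x:{0..}. x * coag_form f f x) = 0" .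
  define e where "e = 1 / rate f"
  define G where "G x = a x * f x - x * f x - e * (x * coag_form f f x)" for x
  have iG: "set_integrable lborel {0..} G"
    unfolding G_def by (intro set_integral_diff set_integrable_mult_right iaf ixf ixJ)
  have cG: "continuous_on {0..} G" unfolding G_def by (intro continuous_intros caf cJ cf)
  have IG: "(LBINT x:{0..}. G x) = (LBINT x:{0..}. a x * f x) - mom1 f"
    using iaf ixf ixJ zero by (simp add: G_def mom1_def)
  have FTC: "(LBINT x:{0..R}. G x) = R * (a R * f R)" if R: "R \<ge> 0" for R
  proof -
    have "(G has_integral R * (a R * f R) - 0 * (a 0 * f 0)) {0..R}"
    proof (rule fundamental_theorem_of_calculus_interior[OF R])
      show "continuous_on {0..R} (\<lambda>x. x * (a x * f x))"
        by (intro continuous_intros continuous_on_subset[OF a_cont] continuous_on_subset[OF cf]) auto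
      fix x assume x: "x \<in> {0<..<R}"
      have "((\<lambda>x. x * (a x * f x)) has_real_derivative G x) (at x)"
        using DERIV_mult[OF DERIV_ident fixed_deriv[of x]] x by (simp add: G_def e_def algebra_simps)
      then show "((\<lambda>x. x * (a x * f x)) has_vector_derivative G x) (at x)"
        by (simp add: has_real_derivative_iff_has_vector_derivative)
    qed
    moreover have "(LBINT x:{0..R}. G x) = integral {0..R} G"
      by (intro set_borel_integral_eq_integral borel_integrable_atLeastAtMost' continuous_on_subset[OF cG]) auto
    ultimately show ?thesis by (simp add: integral_unique)
  qed
  have "((\<lambda>R. LBINT x:{0..R}. G x) \<longlongrightarrow> (LBINT x:{0..}. G x)) at_top"
    by (rule tendsto_set_lebesgue_integral_at_top[OF _ iG]) auto
  moreover have "((\<lambda>R. LBINT x:{0..R}. G x) \<longlongrightarrow> 0) at_top"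
  proof (rule Lim_null_comparison)
    show "\<forall>\<^sub>F R in at_top. norm (LBINT x:{0..R}. G x) \<le> D * (R * exp (- R))"
      using eventually_ge_at_top[of 1]
    proof eventually_elim
      case (elim R)
      have "norm (LBINT x:{0..R}. G x) = R * \<bar>a R * f R\<bar>" using elim by (simp add: FTC abs_mult)
      also have "\<dots> \<le> R * (D * exp (- b * R))" using elim le[of R] z by (intro mult_left_mono) auto
      also have "\<dots> \<le> R * (D * exp (- R))"
      proof -
        have "1 * R \<le> b * R" using elim b1 by (intro mult_right_mono) auto
        then show ?thesis using elim E_ge_1 \<alpha> by (intro mult_left_mono) (auto simp: D_def)
      qed
      finally show ?case by (simp add: mult_ac)
    qed
    have "((\<lambda>R::real. R ^ 1 / exp R) \<longlongrightarrow> 0) at_top" by (rule tendsto_power_div_exp_0)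
    then have "((\<lambda>R::real. R * exp (- R)) \<longlongrightarrow> 0) at_top" by (simp add: exp_minus divide_inverse)
    from tendsto_mult_right_zero[OF this] show "((\<lambda>R. D * (R * exp (- R))) \<longlongrightarrow> 0) at_top" .
  qed
  ultimately have "(LBINT x:{0..}. G x) = 0" by (rule tendsto_unique[rotated 1]) simp
  then show "(LBINT x:{0..}. a x * f x) = mom1 f" using IG by simp
qed

end

lemma steady_state_exists:
  obtains f \<epsilon> where "\<epsilon> > 0" "dominated b (8 * E / \<alpha>) f" "\<And>x. x \<ge> 0 \<Longrightarrow> 0 \<le> f x"
    "\<And>x. x > 0 \<Longrightarrow> ((\<lambda>x. a x * f x) has_real_derivative - f x - \<epsilon> * coagulation f x) (at x)"
    "set_integrable lborel {0..} (\<lambda>x. a x * f x)" "(LBINT x:{0..}. a x * f x) = mom1 f"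
    "0 < mom0 f" "0 < mom1 f"
proof -
  obtain f where f: "adm f" and fixed: "\<And>x. x \<ge> 0 \<Longrightarrow> step f x = f x"
    using fixed_point_exists by blast
  have "coagulation f x = coag_form f f x" for x
    using coagulation_eq_coag_form[OF adm_dominated[OF f]] b by simp
  then show ?thesis
    using that[of "1 / rate f" f] rate_pos[OF f] adm_dominated[OF f] adm_nonneg[OF f]
      fixed_deriv[OF f fixed] fixed_moment_identity[OF f fixed] adm_moments_pos[OF f] by simp
qed

end

context drift
begin

text \<open>
  With \<open>p = P(z\<^sub>0)\<close>, the tail bound in \<open>barrier\<close> is used as an equation for \<open>E\<close>, namely \<open>E\<^sup>2 = \<kappa> \<alpha>\<^sup>3 p\<close>, and
  \<open>b\<close> is read off from \<open>E = exp (b z\<^sub>0)\<close>. Every other condition then asks that \<open>\<alpha>\<^sup>5 p\<close> exceed one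
  of the four summands, which depend on neither \<open>\<alpha>\<close> nor \<open>p\<close>.
\<close>

lemma barrier_parameters:
  fixes h :: real
  defines "c \<equiv> z\<^sub>0 * h\<^sup>2 * (z\<^sub>1 - z\<^sub>0 / 2)\<^sup>2 / 16"
  defines "\<kappa> \<equiv> c\<^sup>2 * c\<^sub>0 / (520 * 320)"
  assumes h: "0 < h" "h \<le> 1"
    and near: "\<And>x. 0 \<le> x \<Longrightarrow> x \<le> z\<^sub>1 \<Longrightarrow> h \<le> 1 / (a x * P x)"
    and c01: "c\<^sub>0 \<le> 1"
    and large: "200 / (c * h) + 200000\<^sup>2 * \<kappa> / c^4 + 320\<^sup>2 * \<kappa> / (c\<^sup>2 * c\<^sub>0\<^sup>2) + exp (2 * (1 / c\<^sub>0 + 1)) / \<kappa>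
       \<le> \<alpha>^5 * P z\<^sub>0"
  shows "\<exists>\<tau> b E. barrier a \<alpha> c\<^sub>0 z\<^sub>0 z\<^sub>1 h \<tau> b c E"
proof -
  define p where "p = P z\<^sub>0"
  have p: "0 < p" by (simp add: p_def P_pos)
  have c: "0 < c" using z h by (simp add: c_def)
  have \<kappa>: "0 < \<kappa>" using c c\<^sub>0 by (simp add: \<kappa>_def)
  define Q where "Q = \<alpha>^5 * p"
  have "0 \<le> 200 / (c * h)" "0 \<le> 200000\<^sup>2 * \<kappa> / c^4" "0 \<le> 320\<^sup>2 * \<kappa> / (c\<^sup>2 * c\<^sub>0\<^sup>2)"
      "0 \<le> exp (2 * (1 / c\<^sub>0 + 1)) / \<kappa>"
    using c h \<kappa> by auto
  then have L: "200 / (c * h) \<le> Q" "200000\<^sup>2 * \<kappa> / c^4 \<le> Q" "320\<^sup>2 * \<kappa> / (c\<^sup>2 * c\<^sub>0\<^sup>2) \<le> Q"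
      "exp (2 * (1 / c\<^sub>0 + 1)) / \<kappa> \<le> Q"
    using large unfolding Q_def p_def by linarith+
  have Q3: "Q \<le> \<alpha>^3 * p"
    unfolding Q_def using \<alpha> p by (intro mult_right_mono power_decreasing) auto
  define \<tau> where "\<tau> = \<alpha> * c / 520"
  define E where "E = sqrt (\<kappa> * \<alpha>^3 * p)"
  define b where "b = ln E / z\<^sub>0"
  have E2: "E\<^sup>2 = \<kappa> * \<alpha>^3 * p" using \<kappa> \<alpha> p by (simp add: E_def)
  have E: "0 < E" using \<kappa> \<alpha> p by (simp add: E_def)
  have "exp (2 * (1 / c\<^sub>0 + 1)) \<le> \<kappa> * Q" using L(4) \<kappa> by (simp add: divide_le_eq mult.commute)
  also have "\<dots> \<le> \<kappa> * (\<alpha>^3 * p)" using Q3 \<kappa> by (intro mult_left_mono) auto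
  finally have "exp (2 * (1 / c\<^sub>0 + 1)) \<le> E\<^sup>2" by (simp add: E2 mult.assoc)
  then have "(exp (1 / c\<^sub>0 + 1))\<^sup>2 \<le> E\<^sup>2" unfolding exp_double .
  then have "exp (1 / c\<^sub>0 + 1) \<le> E" using E by (auto intro: power2_le_imp_le)
  then have lnE: "1 / c\<^sub>0 + 1 \<le> ln E" using E by (simp add: ln_ge_iff)
  have c0': "1 \<le> 1 / c\<^sub>0" using c\<^sub>0 c01 by simp
  have b: "1 / c\<^sub>0 + 1 \<le> b"
  proof -
    have "ln E * z\<^sub>0 \<le> ln E * 1" using lnE c0' z by (intro mult_left_mono) auto
    then have "ln E \<le> b" unfolding b_def using z by (simp add: le_divide_eq)
    then show ?thesis using lnE by simp
  qed
  have "barrier a \<alpha> c\<^sub>0 z\<^sub>0 z\<^sub>1 h \<tau> b c E"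
  proof (unfold_locales)
    show "0 < h" "h \<le> 1" by fact+
    show "\<And>x. 0 \<le> x \<Longrightarrow> x \<le> z\<^sub>1 \<Longrightarrow> h \<le> 1 / (a x * P x)" by fact
    show "2 \<le> b" "1 / c\<^sub>0 + 1 \<le> b" using b c0' by auto
    show "E = exp (b * z\<^sub>0)" using E z by (simp add: b_def)
    show "c = z\<^sub>0 * h\<^sup>2 * (z\<^sub>1 - z\<^sub>0 / 2)\<^sup>2 / 16" by (simp add: c_def)
    show "0 < \<tau>" "520 * \<tau> \<le> \<alpha> * c" using \<alpha> c by (auto simp: \<tau>_def)
    have "200 \<le> (c * h) * Q" using L(1) c h by (simp add: divide_le_eq mult.commute)
    also have "\<dots> \<le> (c * h) * (\<alpha>^3 * p)" using Q3 c h by (intro mult_left_mono) auto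
    finally show "200 \<le> c * \<alpha>^3 * h * P z\<^sub>0" by (simp add: p_def mult_ac)
    show "320 * E\<^sup>2 \<le> \<tau> * \<alpha>\<^sup>2 * c * c\<^sub>0 * P z\<^sub>0"
      unfolding E2 by (simp add: \<kappa>_def \<tau>_def p_def power2_eq_square power3_eq_cube)
    show "200000 * E \<le> c\<^sup>2 * \<alpha>^4 * P z\<^sub>0"
    proof (rule power2_le_imp_le)
      have "200000\<^sup>2 * \<kappa> \<le> c^4 * Q" using L(2) c by (simp add: divide_le_eq mult.commute)
      then have "200000\<^sup>2 * \<kappa> * (\<alpha>^3 * p) \<le> c^4 * Q * (\<alpha>^3 * p)" using \<alpha> p by (intro mult_right_mono) auto
      also have "\<dots> = (c\<^sup>2 * \<alpha>^4 * p)\<^sup>2"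
        unfolding Q_def by (simp add: power2_eq_square power4_eq_xxxx eval_nat_numeral)
      finally show "(200000 * E)\<^sup>2 \<le> (c\<^sup>2 * \<alpha>^4 * P z\<^sub>0)\<^sup>2"
        unfolding power_mult_distrib[of 200000 E] E2 by (simp add: p_def mult_ac)
    qed (simp add: P_nonneg)
    show "320 * E \<le> \<alpha> * c * c\<^sub>0 * P z\<^sub>0"
    proof (rule power2_le_imp_le)
      have "320\<^sup>2 * \<kappa> \<le> (c\<^sup>2 * c\<^sub>0\<^sup>2) * Q" using L(3) c c\<^sub>0 by (simp add: divide_le_eq mult.commute)
      then have "320\<^sup>2 * \<kappa> * (\<alpha>^3 * p) \<le> (c\<^sup>2 * c\<^sub>0\<^sup>2) * Q * (\<alpha>^3 * p)" using \<alpha> p by (intro mult_right_mono) auto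
      also have "\<dots> = (c\<^sup>2 * c\<^sub>0\<^sup>2 * p\<^sup>2) * \<alpha>^8"
        unfolding Q_def by (simp add: power2_eq_square eval_nat_numeral)
      also have "\<dots> \<le> (c\<^sup>2 * c\<^sub>0\<^sup>2 * p\<^sup>2) * \<alpha>\<^sup>2"
        using \<alpha> by (intro mult_left_mono power_decreasing) auto
      finally show "(320 * E)\<^sup>2 \<le> (\<alpha> * c * c\<^sub>0 * P z\<^sub>0)\<^sup>2"
        unfolding power_mult_distrib[of 320 E] E2 by (simp add: p_def power_mult_distrib mult_ac)
    qed (use \<alpha> c c\<^sub>0 P_pos[of z\<^sub>0] in auto)
  qed
  then show ?thesis by blast
qed

end

section \<open>The LSW drift close to the critical value\<close>

definition lsw_drift :: "real \<Rightarrow> real \<Rightarrow> real" where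
  "lsw_drift lam x = x + 1 - lam * x powr (1 / 3)"

text \<open>
  The position of the bottleneck in the variable \<open>x\<^sup>1\<^sup>/\<^sup>3\<close>.
\<close>

definition r\<^sub>0 :: real where "r\<^sub>0 = (1 / 2) powr (1 / 3)"

lemma r0_cube: "r\<^sub>0 ^ 3 = 1 / 2" and r0_pos: "0 < r\<^sub>0" and lambda_LSW_r0: "lambda_LSW = 3 * r\<^sub>0\<^sup>2"
  by (simp_all add: r\<^sub>0_def lambda_LSW_def powr_realpow[symmetric] powr_powr)

lemma r0_bounds: "79 / 100 < r\<^sub>0" "r\<^sub>0 < 8 / 10"
proof -
  have "(79 / 100 :: real)^3 < r\<^sub>0^3" "r\<^sub>0^3 < (8 / 10)^3" unfolding r0_cube by (simp_all add: eval_nat_numeral)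
  then show "79 / 100 < r\<^sub>0" "r\<^sub>0 < 8 / 10"
    using r0_pos power_less_imp_less_base[of "79 / 100" 3 r\<^sub>0] power_less_imp_less_base[of r\<^sub>0 3 "8 / 10"] by auto
qed

lemma lambda_LSW_ge: "18 / 10 \<le> lambda_LSW"
proof -
  have "(79 / 100)\<^sup>2 \<le> r\<^sub>0\<^sup>2" using r0_bounds by (intro power_mono) auto
  then show ?thesis by (simp add: lambda_LSW_r0 power2_eq_square)
qed

lemma cube_root: 
  fixes x :: real assumes "0 \<le> x"
  shows "(x powr (1 / 3)) ^ 3 = x" "0 \<le> x powr (1 / 3)"
  using assms by (cases "x = 0"; simp add: powr_realpow[symmetric] powr_powr)+

text \<open>
  At the critical value the drift is \<open>u\<^sup>3 - 3 r\<^sub>0\<^sup>2 u + 2 r\<^sub>0\<^sup>3\<close> in terms of \<open>u = x\<^sup>1\<^sup>/\<^sup>3\<close>, with a double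
  root at \<open>r\<^sub>0\<close>. All quantitative information on the bottleneck is read off from this.
\<close>

lemma lsw_drift_factor:
  assumes "0 \<le> x"
  defines "u \<equiv> x powr (1 / 3)"
  shows "lsw_drift lam x = (u - r\<^sub>0)\<^sup>2 * (u + 2 * r\<^sub>0) + (lambda_LSW - lam) * u"
proof -
  have "(u - r\<^sub>0)\<^sup>2 * (u + 2 * r\<^sub>0) = u^3 - 3 * r\<^sub>0\<^sup>2 * u + 2 * r\<^sub>0^3"
    by (simp add: power2_eq_square power3_eq_cube algebra_simps)
  also have "\<dots> = x - lambda_LSW * u + 1"
    using cube_root(1)[OF assms(1)] by (simp add: u_def r0_cube lambda_LSW_r0)
  finally show ?thesis by (simp add: lsw_drift_def u_def algebra_simps)
qed

lemma lsw_drift_continuous: "continuous_on {0..} (lsw_drift lam)"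
proof -
  have "continuous_on {0..} (\<lambda>x::real. x powr (1 / 3))"
    by (intro continuous_on_powr' continuous_intros) auto
  then show ?thesis
    unfolding lsw_drift_def by (intro continuous_on_diff continuous_on_add continuous_on_mult continuous_on_const continuous_on_id)
qed

lemma cube_root_ge:
  fixes v x :: real
  assumes "0 \<le> v" "v^3 \<le> x" shows "v \<le> x powr (1 / 3)"
proof (rule power_le_imp_le_base)
  have "0 \<le> x" using assms by (meson order_trans zero_le_power)
  then show "v ^ Suc 2 \<le> (x powr (1 / 3)) ^ Suc 2" "0 \<le> x powr (1 / 3)"
    using assms cube_root[of x] by (simp_all add: eval_nat_numeral)
qed

lemma cube_root_le:
  fixes v x :: real
  assumes "0 \<le> v" "0 \<le> x" "x \<le> v^3" shows "x powr (1 / 3) \<le> v"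
  by (rule power_le_imp_le_base[of _ 2]) (use assms cube_root[of x] in \<open>simp_all add: eval_nat_numeral\<close>)

context
  fixes lam \<delta> :: real
  assumes \<delta>_def: "\<delta> = lambda_LSW - lam" and \<delta>: "0 < \<delta>" "\<delta> \<le> 1 / 100"
begin

lemma lsw_drift_ge:
  assumes "0 \<le> x" shows "\<delta> / 4 \<le> lsw_drift lam x"
proof -
  define u where "u = x powr (1 / 3)"
  have u: "0 \<le> u" by (simp add: u_def)
  have eq: "lsw_drift lam x = (u - r\<^sub>0)\<^sup>2 * (u + 2 * r\<^sub>0) + \<delta> * u"
    unfolding u_def \<delta>_def by (rule lsw_drift_factor[OF assms])
  show ?thesis
  proof (cases "r\<^sub>0 / 2 \<le> u")
    case True
    have "\<delta> * (1 / 4) \<le> \<delta> * u" using True r0_bounds \<delta> by (intro mult_left_mono) auto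
    moreover have "0 \<le> (u - r\<^sub>0)\<^sup>2 * (u + 2 * r\<^sub>0)" using u r0_pos by simp
    ultimately show ?thesis by (simp add: eq)
  next
    case False
    have "(r\<^sub>0 / 2)\<^sup>2 \<le> (r\<^sub>0 - u)\<^sup>2" using False r0_pos by (intro power_mono) auto
    then have "(r\<^sub>0 / 2)\<^sup>2 * (2 * r\<^sub>0) \<le> (u - r\<^sub>0)\<^sup>2 * (u + 2 * r\<^sub>0)"
      using u r0_pos by (intro mult_mono) (auto simp: power2_commute)
    moreover have "(r\<^sub>0 / 2)\<^sup>2 * (2 * r\<^sub>0) = 1 / 4" using r0_cube by (simp add: power2_eq_square power3_eq_cube)
    moreover have "0 \<le> \<delta> * u" using u \<delta> by simp
    ultimately show ?thesis using \<delta> by (simp add: eq)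
  qed
qed

lemma lsw_drift_far:
  assumes "3 / 5 \<le> x" shows "1 / 1200 * (1 + x) \<le> lsw_drift lam x"
proof -
  have x: "0 \<le> x" using assms by simp
  define u where "u = x powr (1 / 3)"
  have u3: "u^3 = x" unfolding u_def by (rule cube_root[OF x])
  \<comment> \<open>\<open>(84/100)\<^sup>3 \<le> 3/5\<close>, and \<open>r\<^sub>0\<close> lies below \<open>80/100\<close>\<close>
  have u: "84 / 100 \<le> u" unfolding u_def by (rule cube_root_ge) (use assms in \<open>simp_all add: eval_nat_numeral\<close>)
  have "u / 21 \<le> u - r\<^sub>0" using u r0_bounds by simp
  then have "(u / 21)\<^sup>2 * u \<le> (u - r\<^sub>0)\<^sup>2 * (u + 2 * r\<^sub>0)"
    using u r0_pos by (intro mult_mono power_mono) auto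
  moreover have "(u / 21)\<^sup>2 * u = x / 441" using u3 by (simp add: power2_eq_square power3_eq_cube)
  moreover have "0 \<le> \<delta> * u" using u \<delta> by simp
  moreover have "lsw_drift lam x = (u - r\<^sub>0)\<^sup>2 * (u + 2 * r\<^sub>0) + \<delta> * u"
    unfolding u_def \<delta>_def by (rule lsw_drift_factor[OF x])
  ultimately show ?thesis using assms by simp
qed

lemma lsw_drift_near:
  assumes "0 \<le> x" "x \<le> 2 / 5" shows "1 / 300 \<le> lsw_drift lam x"
proof -
  define u where "u = x powr (1 / 3)"
  have u: "0 \<le> u" by (simp add: u_def)
  \<comment> \<open>\<open>(74/100)\<^sup>3 \<ge> 2/5\<close>, and \<open>r\<^sub>0\<close> lies above \<open>79/100\<close>\<close>
  have u': "u \<le> 74 / 100" unfolding u_def by (rule cube_root_le) (use assms in \<open>simp_all add: eval_nat_numeral\<close>)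
  have "(5 / 100)\<^sup>2 \<le> (r\<^sub>0 - u)\<^sup>2" using u' r0_bounds by (intro power_mono) auto
  then have "(5 / 100)\<^sup>2 * (158 / 100) \<le> (u - r\<^sub>0)\<^sup>2 * (u + 2 * r\<^sub>0)"
    using u r0_bounds by (intro mult_mono) (auto simp: power2_commute)
  moreover have "0 \<le> \<delta> * u" using u \<delta> by simp
  moreover have "lsw_drift lam x = (u - r\<^sub>0)\<^sup>2 * (u + 2 * r\<^sub>0) + \<delta> * u"
    unfolding u_def \<delta>_def by (rule lsw_drift_factor[OF assms(1)])
  ultimately show ?thesis by (simp add: power2_eq_square)
qed

lemma lsw_drift_le:
  assumes "2 / 5 \<le> x" shows "lsw_drift lam x \<le> x"
proof -
  \<comment> \<open>\<open>\<lambda> x\<^sup>1\<^sup>/\<^sup>3 \<ge> 1\<close> once \<open>\<lambda> \<ge> 3/2\<close> and \<open>x \<ge> 8/27\<close>\<close>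
  have "2 / 3 \<le> x powr (1 / 3)" by (rule cube_root_ge) (use assms in \<open>simp_all add: eval_nat_numeral\<close>)
  moreover have "3 / 2 \<le> lam" using lambda_LSW_ge \<delta> \<delta>_def by simp
  ultimately have "3 / 2 * (2 / 3) \<le> lam * x powr (1 / 3)" by (intro mult_mono) auto
  then show ?thesis by (simp add: lsw_drift_def)
qed

text \<open>
  The double root makes the drift at most \<open>4 \<delta>\<close> on an interval of length \<open>\<surd>\<delta>\<close>, so that crossing it
  contributes at least \<open>1 / (4 \<surd>\<delta>)\<close> to \<open>\<integral> 1/a\<close>.
\<close>

lemma lsw_drift_valley:
  assumes "1 / 2 \<le> x" "x \<le> 1 / 2 + sqrt \<delta>" shows "lsw_drift lam x \<le> 4 * \<delta>"
proof -
  have x: "0 \<le> x" using assms by simp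
  have "sqrt \<delta> \<le> sqrt ((1 / 10)\<^sup>2)" using \<delta> by (intro real_sqrt_le_mono) (simp add: power2_eq_square)
  then have s: "sqrt \<delta> \<le> 1 / 10" by (simp add: real_sqrt_abs)
  define u where "u = x powr (1 / 3)"
  have u3: "u^3 = x" unfolding u_def by (rule cube_root[OF x])
  have u1: "u \<le> 1" unfolding u_def by (rule cube_root_le) (use assms s in auto)
  have u0: "r\<^sub>0 \<le> u" unfolding u_def by (rule cube_root_ge) (use assms r0_pos in \<open>auto simp: r0_cube\<close>)
  have "(u - r\<^sub>0) * 1 \<le> (u - r\<^sub>0) * (u\<^sup>2 + u * r\<^sub>0 + r\<^sub>0\<^sup>2)"
  proof (rule mult_left_mono)
    have "(79 / 100)\<^sup>2 \<le> r\<^sub>0\<^sup>2" "(79 / 100)\<^sup>2 \<le> u\<^sup>2" using r0_bounds u0 by (auto intro!: power_mono)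
    moreover have "0 \<le> u * r\<^sub>0" using u0 r0_pos by simp
    ultimately show "1 \<le> u\<^sup>2 + u * r\<^sub>0 + r\<^sub>0\<^sup>2" by (simp add: power2_eq_square)
  qed (use u0 in simp)
  also have "\<dots> = u^3 - r\<^sub>0^3" by (simp add: power2_eq_square power3_eq_cube algebra_simps)
  also have "\<dots> \<le> sqrt \<delta>" using assms by (simp add: u3 r0_cube)
  finally have "(u - r\<^sub>0)\<^sup>2 \<le> (sqrt \<delta>)\<^sup>2" using u0 by (intro power_mono) auto
  then have "(u - r\<^sub>0)\<^sup>2 * (u + 2 * r\<^sub>0) \<le> \<delta> * 3"
    using u0 u1 r0_bounds \<delta> by (intro mult_mono) auto
  moreover have "\<delta> * u \<le> \<delta> * 1" using u1 \<delta> by (intro mult_left_mono) auto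
  moreover have "lsw_drift lam x = (u - r\<^sub>0)\<^sup>2 * (u + 2 * r\<^sub>0) + \<delta> * u"
    unfolding u_def \<delta>_def by (rule lsw_drift_factor[OF x])
  ultimately show ?thesis by simp
qed

lemma lsw_is_drift: "drift (lsw_drift lam) (\<delta> / 4) (1 / 1200) (3 / 5) (2 / 5)"
  by unfold_locales
    (use \<delta> lsw_drift_continuous lsw_drift_ge lsw_drift_far lsw_drift_le in auto)

text \<open>
  In front of the bottleneck the drift is bounded below by a constant that does not depend on
  \<open>\<delta>\<close>, so the profile is bounded below uniformly in \<open>\<delta>\<close>.
\<close>

lemma lsw_near:
  assumes "0 \<le> x" "x \<le> 2 / 5"
  shows "exp (- 120) / 2 \<le> 1 / (lsw_drift lam x * drift.P (lsw_drift lam) x)"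
proof -
  interpret drift "lsw_drift lam" "\<delta> / 4" "1 / 1200" "3 / 5" "2 / 5" by (rule lsw_is_drift)
  have "0 \<le> lam * x powr (1 / 3)" using lambda_LSW_ge \<delta> \<delta>_def by simp
  then have a2: "lsw_drift lam x \<le> 2" using assms by (simp add: lsw_drift_def)
  have "P x \<le> P 0 * exp ((x - 0) / (1 / 300))"
    using assms lsw_drift_near by (intro P_le_exp) auto
  also have "\<dots> \<le> exp 120" using assms by (simp add: P_0)
  finally have "lsw_drift lam x * P x \<le> 2 * exp 120"
    using a2 P_pos[of x] by (intro mult_mono) auto
  then have "1 / (2 * exp 120) \<le> 1 / (lsw_drift lam x * P x)"
    using a_pos[OF assms(1)] P_pos[of x] by (intro divide_left_mono) auto
  moreover have "exp (- 120 :: real) / 2 = 1 / (2 * exp 120)"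
    unfolding exp_minus by (simp add: inverse_eq_divide)
  ultimately show ?thesis by simp
qed

lemma lsw_P_large: "exp (1 / (4 * sqrt \<delta>)) \<le> drift.P (lsw_drift lam) (3 / 5)"
proof -
  interpret drift "lsw_drift lam" "\<delta> / 4" "1 / 1200" "3 / 5" "2 / 5" by (rule lsw_is_drift)
  have "sqrt \<delta> \<le> sqrt ((1 / 10)\<^sup>2)" using \<delta> by (intro real_sqrt_le_mono) (simp add: power2_eq_square)
  then have s: "0 < sqrt \<delta>" "sqrt \<delta> \<le> 1 / 10" using \<delta> by (simp_all add: real_sqrt_abs)
  have "(1 / 2 + sqrt \<delta> - 1 / 2) / (4 * \<delta>) = sqrt \<delta> / (4 * (sqrt \<delta> * sqrt \<delta>))" using \<delta> by simp
  also have "\<dots> = 1 / (4 * sqrt \<delta>)" using s by (simp del: real_sqrt_mult_self)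
  finally have "exp (1 / (4 * sqrt \<delta>)) = 1 * exp ((1 / 2 + sqrt \<delta> - 1 / 2) / (4 * \<delta>))" by simp
  also have "\<dots> \<le> P (1 / 2) * exp ((1 / 2 + sqrt \<delta> - 1 / 2) / (4 * \<delta>))"
    using P_ge_1[of "1 / 2"] by (intro mult_right_mono) auto
  also have "\<dots> \<le> P (1 / 2 + sqrt \<delta>)"
    using s lsw_drift_valley by (intro P_ge_exp) auto
  also have "\<dots> \<le> P (3 / 5)" using s by (intro P_mono) auto
  finally show ?thesis .
qed

end

lemma exists_small_delta: "\<exists>\<delta>\<^sub>1>0. \<forall>\<delta>. 0 < \<delta> \<and> \<delta> < \<delta>\<^sub>1 \<longrightarrow> M \<le> (\<delta> / 4)^5 * exp (1 / (4 * sqrt \<delta>))"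
proof -
  have "filterlim (\<lambda>\<delta>::real. (\<delta> / 4)^5 * exp (1 / (4 * sqrt \<delta>))) at_top (at_right 0)"
    by real_asymp
  then have "eventually (\<lambda>\<delta>. M \<le> (\<delta> / 4)^5 * exp (1 / (4 * sqrt \<delta>))) (at_right 0)"
    by (simp add: filterlim_at_top)
  then show ?thesis by (auto simp: eventually_at_right_field)
qed

section \<open>Existence of self-similar solutions\<close>

text \<open>
  Dividing a steady state by its first moment \<open>m\<close> normalises it and multiplies \<open>\<epsilon>\<close> by \<open>m\<close>. The
  moment identity \<open>\<integral> a f = \<integral> x f\<close> says \<open>\<integral> f = \<lambda> \<integral> x\<^sup>1\<^sup>/\<^sup>3 f\<close>.
\<close>

lemma lsw_steady_state:
  assumes "\<epsilon> > 0" "dominated b D f" "1 \<le> b" "\<And>x. x \<ge> 0 \<Longrightarrow> 0 \<le> f x"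
    and ode: "\<And>x. x > 0 \<Longrightarrow> ((\<lambda>x. lsw_drift lam x * f x) has_real_derivative - f x - \<epsilon> * coagulation f x) (at x)"
    and ia: "set_integrable lborel {0..} (\<lambda>x. lsw_drift lam x * f x)"
    and mi: "(LBINT x:{0..}. lsw_drift lam x * f x) = mom1 f"
    and mpos: "0 < mom0 f" "0 < mom1 f"
    and apos: "\<And>x. x > 0 \<Longrightarrow> 0 < lsw_drift lam x" and lam: "lam \<noteq> 0"
  shows "\<exists>(\<epsilon>::real) (\<Phi>::real \<Rightarrow> real).
       \<epsilon> > 0 \<and> classical_regularity \<Phi> \<and> exponentially_decaying \<Phi> \<and>
       (\<forall>z>0. - z * deriv \<Phi> z - 2 * \<Phi> z
              + deriv (\<lambda>x. (- 1 + lam * x powr (1 / 3)) * \<Phi> x) z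
            = \<epsilon> * coagulation \<Phi> z) \<and>
       (LBINT z:{0..}. z * \<Phi> z) = 1 \<and>
       (\<forall>z\<ge>0. \<Phi> z \<ge> 0) \<and>
       lam = (LBINT z:{0..}. \<Phi> z) / (LBINT z:{0..}. z powr (1 / 3) * \<Phi> z)"
proof -
  define m where "m = mom1 f"
  have m: "0 < m" using mpos by (simp add: m_def)
  define \<Phi> where "\<Phi> x = f x / m" for x
  define X where "X x = lsw_drift lam x * f x" for x
  define X' where "X' x = - f x - \<epsilon> * coagulation f x" for x
  define a' where "a' x = 1 - lam * (x powr (1 / 3 - 1) * (1 / 3))" for x :: real
  define f' where "f' x = (X' x * lsw_drift lam x - X x * a' x) / (lsw_drift lam x * lsw_drift lam x)" for x
  have cf: "continuous_on {0..} f" by (rule dominatedD(1)[OF assms(2)])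
  have da: "(lsw_drift lam has_real_derivative a' x) (at x)" if "x > 0" for x
    unfolding lsw_drift_def a'_def using that
    by (auto intro!: derivative_eq_intros simp: powr_diff)
  have df: "(f has_real_derivative f' x) (at x)" if x: "x > 0" for x
  proof -
    have "((\<lambda>x. X x / lsw_drift lam x) has_real_derivative f' x) (at x)"
      unfolding f'_def X'_def X_def
      by (rule DERIV_divide[OF ode[OF x] da[OF x]]) (use apos[OF x] in auto)
    then show ?thesis
      by (rule has_field_derivative_transform_within_open[of _ _ _ "{0<..}"])
         (use x apos in \<open>auto simp: X_def less_imp_neq[symmetric]\<close>)
  qed
  have cJ: "continuous_on {0..} (coagulation f)"
    using continuous_on_coag_form[OF cf cf] coagulation_eq_coag_form[OF assms(2,3)]
    by (auto intro: continuous_on_eq)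
  have ca: "continuous_on {0<..} (lsw_drift lam)"
    by (rule continuous_on_subset[OF lsw_drift_continuous]) auto
  have cf': "continuous_on {0<..} f'"
  proof -
    have root: "continuous_on {0<..} (\<lambda>x::real. x powr (1 / 3 - 1))"
      by (intro continuous_on_powr continuous_on_const continuous_on_id) auto
    have sub: "continuous_on {0<..} f" "continuous_on {0<..} (coagulation f)"
      by (rule continuous_on_subset[OF cf], auto) (rule continuous_on_subset[OF cJ], auto)
    show ?thesis
      unfolding f'_def X'_def X_def a'_def
      by (intro continuous_on_divide continuous_on_diff continuous_on_mult continuous_on_const continuous_on_minus root sub ca)
         (use apos in \<open>auto simp: less_imp_neq[symmetric]\<close>)
  qed
  have d\<Phi>: "(\<Phi> has_real_derivative f' x / m) (at x)" if "x > 0" for x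
    unfolding \<Phi>_def by (intro DERIV_cdivide df that)
  have reg: "classical_regularity \<Phi>"
    unfolding classical_regularity_def
  proof
    show "continuous_on {0..} \<Phi>" unfolding \<Phi>_def using m by (intro continuous_intros cf) auto
    show "\<Phi> C1_differentiable_on {0<..}"
      unfolding C1_differentiable_on_def
    proof (intro exI conjI ballI)
      show "(\<Phi> has_vector_derivative f' x / m) (at x)" if "x \<in> {0<..}" for x
        using d\<Phi>[of x] that by (simp add: has_real_derivative_iff_has_vector_derivative)
      show "continuous_on {0<..} (\<lambda>x. f' x / m)" using m by (intro continuous_intros cf') auto
    qed
  qed
  have decay: "exponentially_decaying \<Phi>"
    unfolding exponentially_decaying_def
  proof (intro exI conjI)
    show "b > 0" using assms(3) by simp
    show "bdd_above ((\<lambda>z. \<bar>\<Phi> z\<bar> * exp (b * z)) ` {0..})"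
    proof (rule bdd_aboveI2)
      fix x :: real assume "x \<in> {0..}"
      then have "\<bar>f x\<bar> \<le> D * exp (- b * x)" using dominated_le_exp(1)[OF assms(2)] by simp
      then have "\<bar>f x\<bar> * exp (b * x) \<le> D * exp (- b * x) * exp (b * x)" by (rule mult_right_mono) simp
      also have "\<dots> = D" by (simp add: mult.assoc mult_exp_exp)
      finally show "\<bar>\<Phi> x\<bar> * exp (b * x) \<le> D / m" using m by (simp add: \<Phi>_def divide_right_mono)
    qed
  qed
  have coag: "coagulation \<Phi> x = coagulation f x / m\<^sup>2" for x
  proof -
    have "(LBINT y:{0..x}. x * \<Phi> (x - y) * \<Phi> y) = (LBINT y:{0..x}. x * f (x - y) * f y / m\<^sup>2)"
      by (rule set_lebesgue_integral_cong) (auto simp: \<Phi>_def power2_eq_square)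
    moreover have "(LBINT y:{0..}. (x + y) * \<Phi> y) = (LBINT y:{0..}. (x + y) * f y / m)"
      by (rule set_lebesgue_integral_cong) (auto simp: \<Phi>_def)
    ultimately show ?thesis
      unfolding coagulation_def by (simp add: \<Phi>_def power2_eq_square diff_divide_distrib)
  qed
  have eq: "- z * deriv \<Phi> z - 2 * \<Phi> z + deriv (\<lambda>x. (- 1 + lam * x powr (1 / 3)) * \<Phi> x) z
            = (\<epsilon> * m) * coagulation \<Phi> z" if z: "z > 0" for z
  proof -
    have 1: "deriv \<Phi> z = f' z / m" by (rule DERIV_imp_deriv[OF d\<Phi>[OF z]])
    have "((\<lambda>x. x * \<Phi> x - X x / m) has_real_derivative (1 * \<Phi> z + f' z / m * z) - X' z / m) (at z)"
      unfolding X_def X'_def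
      by (intro DERIV_diff DERIV_mult DERIV_ident d\<Phi> z DERIV_cdivide ode)
    moreover have "(\<lambda>x. x * \<Phi> x - X x / m) = (\<lambda>x. (- 1 + lam * x powr (1 / 3)) * \<Phi> x)"
      by (rule ext) (simp add: X_def \<Phi>_def lsw_drift_def diff_divide_distrib add_divide_distrib algebra_simps)
    ultimately have 2: "deriv (\<lambda>x. (- 1 + lam * x powr (1 / 3)) * \<Phi> x) z = (1 * \<Phi> z + f' z / m * z) - X' z / m"
      by (intro DERIV_imp_deriv) simp
    have "- z * deriv \<Phi> z - 2 * \<Phi> z + deriv (\<lambda>x. (- 1 + lam * x powr (1 / 3)) * \<Phi> x) z = \<epsilon> * coagulation f z / m"
      unfolding 1 2 by (simp add: X'_def \<Phi>_def diff_divide_distrib)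
    then show ?thesis using m by (simp add: coag power2_eq_square)
  qed
  have M1: "(LBINT z:{0..}. z * \<Phi> z) = 1"
  proof -
    have "(LBINT z:{0..}. z * \<Phi> z) = (LBINT z:{0..}. z * f z / m)" by (simp add: \<Phi>_def)
    also have "\<dots> = mom1 f / m" by (simp add: mom1_def)
    finally show ?thesis using m by (simp add: m_def)
  qed
  note mo = dominated_moments[OF assms(2,3)]
  \<comment> \<open>integrability of the fractional moment is inherited from that of \<open>a f\<close>\<close>
  have cr: "x powr (1 / 3) * f x = (x * f x + f x - lsw_drift lam x * f x) / lam" for x
    using lam by (simp add: lsw_drift_def algebra_simps)
  have "(LBINT z:{0..}. z powr (1 / 3) * f z) = (mom1 f + mom0 f - mom1 f) / lam"
    unfolding cr using mo ia mi by (simp add: mom0_def mom1_def)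
  then have M13: "lam * (LBINT z:{0..}. z powr (1 / 3) * f z) = mom0 f" using lam by simp
  have "(LBINT z:{0..}. \<Phi> z) / (LBINT z:{0..}. z powr (1 / 3) * \<Phi> z)
     = (mom0 f / m) / ((LBINT z:{0..}. z powr (1 / 3) * f z) / m)"
    by (simp add: \<Phi>_def mom0_def)
  also have "\<dots> = lam"
  proof -
    have "(LBINT z:{0..}. z powr (1 / 3) * f z) \<noteq> 0" using M13 mpos by force
    then show ?thesis using M13[symmetric] m by simp
  qed
  finally have L: "lam = (LBINT z:{0..}. \<Phi> z) / (LBINT z:{0..}. z powr (1 / 3) * \<Phi> z)" ..
  have nn: "\<forall>z\<ge>0. \<Phi> z \<ge> 0" using assms(4) m by (simp add: \<Phi>_def)
  have "\<epsilon> * m > 0" using assms(1) m by simp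
  then show ?thesis using reg decay eq M1 nn L by blast
qed

theorem theorem2p1:
  shows "\<exists>\<delta>\<^sub>0>0::real. \<forall>lam::real. 0 < lambda_LSW - lam \<and> lambda_LSW - lam < \<delta>\<^sub>0 \<longrightarrow>
    (\<exists>(\<epsilon>::real) (\<Phi>::real \<Rightarrow> real).
       \<epsilon> > 0 \<and> classical_regularity \<Phi> \<and> exponentially_decaying \<Phi> \<and>
       (\<forall>z>0. - z * deriv \<Phi> z - 2 * \<Phi> z
              + deriv (\<lambda>x. (- 1 + lam * x powr (1 / 3)) * \<Phi> x) z
            = \<epsilon> * coagulation \<Phi> z) \<and>
       (LBINT z:{0..}. z * \<Phi> z) = 1 \<and>
       (\<forall>z\<ge>0. \<Phi> z \<ge> 0) \<and>
       lam = (LBINT z:{0..}. \<Phi> z) / (LBINT z:{0..}. z powr (1 / 3) * \<Phi> z))"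
proof -
  \<comment> \<open>all constants are independent of \<open>\<delta>\<close>; \<open>h\<close> stems from \<open>1/300 \<le> a \<le> 2\<close> on \<open>[0, 2/5]\<close>\<close>
  define h where "h = exp (- 120 :: real) / 2"
  define c where "c = 3 / 5 * h\<^sup>2 * (2 / 5 - 3 / 5 / 2)\<^sup>2 / 16"
  define \<kappa> where "\<kappa> = c\<^sup>2 * (1 / 1200) / (520 * 320)"
  define M where "M = 200 / (c * h) + 200000\<^sup>2 * \<kappa> / c^4 + 320\<^sup>2 * \<kappa> / (c\<^sup>2 * (1 / 1200)\<^sup>2)
    + exp (2 * (1 / (1 / 1200) + 1)) / \<kappa>"
  obtain \<delta>\<^sub>1 where \<delta>\<^sub>1: "\<delta>\<^sub>1 > 0" "\<And>\<delta>. 0 < \<delta> \<Longrightarrow> \<delta> < \<delta>\<^sub>1 \<Longrightarrow> M \<le> (\<delta> / 4)^5 * exp (1 / (4 * sqrt \<delta>))"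
    using exists_small_delta[of M] by blast
  show ?thesis
  proof (rule exI[of _ "min \<delta>\<^sub>1 (1 / 100)"], intro conjI allI impI)
    show "min \<delta>\<^sub>1 (1 / 100) > 0" using \<delta>\<^sub>1 by simp
    fix lam assume lam: "0 < lambda_LSW - lam \<and> lambda_LSW - lam < min \<delta>\<^sub>1 (1 / 100)"
    define \<delta> where "\<delta> = lambda_LSW - lam"
    have \<delta>: "0 < \<delta>" "\<delta> \<le> 1 / 100" "\<delta> < \<delta>\<^sub>1" using lam by (auto simp: \<delta>_def)
    interpret drift "lsw_drift lam" "\<delta> / 4" "1 / 1200" "3 / 5" "2 / 5"
      by (rule lsw_is_drift[OF \<delta>_def \<delta>(1,2)])
    have "exp (- 120 :: real) \<le> 1" by simp
    then have h: "0 < h" "h \<le> 1" unfolding h_def by (simp, linarith)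
    have "M \<le> (\<delta> / 4)^5 * P (3 / 5)"
      by (rule order_trans[OF \<delta>\<^sub>1(2)[OF \<delta>(1,3)]])
         (use \<delta> lsw_P_large[OF \<delta>_def \<delta>(1,2)] in \<open>intro mult_left_mono, auto\<close>)
    then obtain \<tau> b E where "barrier (lsw_drift lam) (\<delta> / 4) (1 / 1200) (3 / 5) (2 / 5) h \<tau> b c E"
      using barrier_parameters[OF h, folded c_def, folded \<kappa>_def, folded M_def]
        lsw_near[OF \<delta>_def \<delta>(1,2), folded h_def] by auto
    then interpret B: barrier "lsw_drift lam" "\<delta> / 4" "1 / 1200" "3 / 5" "2 / 5" h \<tau> b c E .
    obtain f \<epsilon> where f: "\<epsilon> > 0" "dominated b (8 * E / (\<delta> / 4)) f" "\<And>x. x \<ge> 0 \<Longrightarrow> 0 \<le> f x"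
      "\<And>x. x > 0 \<Longrightarrow> ((\<lambda>x. lsw_drift lam x * f x) has_real_derivative - f x - \<epsilon> * coagulation f x) (at x)"
      "set_integrable lborel {0..} (\<lambda>x. lsw_drift lam x * f x)"
      "(LBINT x:{0..}. lsw_drift lam x * f x) = mom1 f" "0 < mom0 f" "0 < mom1 f"
      by (rule B.steady_state_exists) (rule that)
    have "lam \<noteq> 0" "1 \<le> b" using lambda_LSW_ge \<delta> B.b by (auto simp: \<delta>_def)
    then show "\<exists>(\<epsilon>::real) (\<Phi>::real \<Rightarrow> real).
       \<epsilon> > 0 \<and> classical_regularity \<Phi> \<and> exponentially_decaying \<Phi> \<and>
       (\<forall>z>0. - z * deriv \<Phi> z - 2 * \<Phi> z
              + deriv (\<lambda>x. (- 1 + lam * x powr (1 / 3)) * \<Phi> x) z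
            = \<epsilon> * coagulation \<Phi> z) \<and>
       (LBINT z:{0..}. z * \<Phi> z) = 1 \<and>
       (\<forall>z\<ge>0. \<Phi> z \<ge> 0) \<and>
       lam = (LBINT z:{0..}. \<Phi> z) / (LBINT z:{0..}. z powr (1 / 3) * \<Phi> z)"
      using lsw_steady_state[OF f(1,2) _ f(3-8)] a_pos by simp
  qed
qed

end
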